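(* Let $p$ be a prime and $G$ a $p$-group of maximal class of order $p^m$ ($m\ge4$) with positive degree of commutativity. (1) If $G$ possesses an abelian maximal subgroup, then $$B_G(t)=\frac{1}{1-pt}\left(1+\frac{(p^{m-2}-1)t}{1-p^{m-1}t}+\frac{(p^2-p)t}{1-p^2t}\right).$$ (2) If $[P_1,P_3]=1$ and $G$ possesses no abelian maximal subgroup, then $$B_G(t)=\frac{1}{1-pt}\left(1+\frac{(p^{m-4}-1)t(1-p^{m-4}t)}{(1-p^{m-2}t)(1-p^{m-3}t)}+\frac{(p^{m-3}-p^{m-5})t}{1-p^{m-2}t}+\frac{(p^2-p)t}{1-p^2t}\right).$$
   Context: For a finite group $G$ and $n\ge0$, let $G^{(n)}\subseteq G^n$ be the set of $n$-tuples of pairwise commuting elements, on which $G$ acts by simultaneous conjugation; let $\beta_{G,n}$ be the number of orbits and $B_G(t)=\sum_{n\ge0}\beta_{G,n}t^n$. A group of order $p^m$ with $m\ge4$ is of maximal class if it has nilpotency class $m-1$. Let $\gamma_i(G)$ be the lower central series. Define $P_0=G$, $P_1$ to be the centralizer in $G$ of $\gamma_2(G)/\gamma_4(G)$ (i.e. $\{g\in G:[g,\gamma_2(G)]\le\gamma_4(G)\}$), and $P_i=\gamma_i(G)$ for $2\le i\le m$. The degree of commutativity $l$ of $G$ is the maximum integer such that $[P_i,P_j]\le P_{i+j+l}$ for all $i,j\ge1$ if $P_1$ is not abelian (with $P_k=1$ for $k\ge m$), and $l=m-3$ if $P_1$ is abelian. Positive degree of commutativity means $l>0$. *)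

theory Defs
  imports "HOL-Algebra.Generated_Groups" "HOL-Computational_Algebra.Formal_Power_Series"
begin

definition commutator :: "('a, 'b) monoid_scheme \<Rightarrow> 'a \<Rightarrow> 'a \<Rightarrow> 'a" where
  "commutator G x y = inv\<^bsub>G\<^esub> x \<otimes>\<^bsub>G\<^esub> inv\<^bsub>G\<^esub> y \<otimes>\<^bsub>G\<^esub> x \<otimes>\<^bsub>G\<^esub> y"

definition comm_subgroup :: "('a, 'b) monoid_scheme \<Rightarrow> 'a set \<Rightarrow> 'a set \<Rightarrow> 'a set" where
  "comm_subgroup G H K = generate G {commutator G h k | h k. h \<in> H \<and> k \<in> K}"

text \<open>Lower central series, indexed as in the paper: gamma_1 = G, gamma_(i+1) = [gamma_i, G].
  (Index 0 is also set to G for convenience.)\<close>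
fun lower_central :: "('a, 'b) monoid_scheme \<Rightarrow> nat \<Rightarrow> 'a set" where
  "lower_central G 0 = carrier G"
| "lower_central G (Suc 0) = carrier G"
| "lower_central G (Suc (Suc n)) = comm_subgroup G (lower_central G (Suc n)) (carrier G)"

definition nilpotency_class :: "('a, 'b) monoid_scheme \<Rightarrow> nat" where
  "nilpotency_class G = (LEAST c. lower_central G (Suc c) = {\<one>\<^bsub>G\<^esub>})"

definition maximal_class :: "('a, 'b) monoid_scheme \<Rightarrow> nat \<Rightarrow> nat \<Rightarrow> bool" where
  "maximal_class G p m \<longleftrightarrow> group G \<and> finite (carrier G) \<and> prime p \<and> 4 \<le> m
     \<and> order G = p ^ m \<and> nilpotency_class G = m - 1"

definition P_series :: "('a, 'b) monoid_scheme \<Rightarrow> nat \<Rightarrow> int \<Rightarrow> 'a set" where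
  "P_series G m k =
     (if k \<le> 0 then carrier G
      else if k = 1 then {g \<in> carrier G. \<forall>h \<in> lower_central G 2.
                             commutator G g h \<in> lower_central G 4}
      else if k \<ge> int m then {\<one>\<^bsub>G\<^esub>}
      else lower_central G (nat k))"

definition abelian_set :: "('a, 'b) monoid_scheme \<Rightarrow> 'a set \<Rightarrow> bool" where
  "abelian_set G H \<longleftrightarrow> (\<forall>x \<in> H. \<forall>y \<in> H. x \<otimes>\<^bsub>G\<^esub> y = y \<otimes>\<^bsub>G\<^esub> x)"

definition doc_condition :: "('a, 'b) monoid_scheme \<Rightarrow> nat \<Rightarrow> int \<Rightarrow> bool" where
  "doc_condition G m l \<longleftrightarrow> (\<forall>i j. i \<ge> 1 \<longrightarrow> j \<ge> 1 \<longrightarrow>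
      comm_subgroup G (P_series G m i) (P_series G m j) \<subseteq> P_series G m (i + j + l))"

definition degree_of_commutativity :: "('a, 'b) monoid_scheme \<Rightarrow> nat \<Rightarrow> int" where
  "degree_of_commutativity G m =
     (if abelian_set G (P_series G m 1) then int m - 3
      else (GREATEST l. doc_condition G m l))"

definition maximal_subgroup :: "'a set \<Rightarrow> ('a, 'b) monoid_scheme \<Rightarrow> bool" where
  "maximal_subgroup H G \<longleftrightarrow> subgroup H G \<and> H \<noteq> carrier G \<and>
     (\<forall>K. subgroup K G \<longrightarrow> H \<subseteq> K \<longrightarrow> K = H \<or> K = carrier G)"

definition commuting_tuples :: "('a, 'b) monoid_scheme \<Rightarrow> nat \<Rightarrow> 'a list set" where
  "commuting_tuples G n = {xs. length xs = n \<and> set xs \<subseteq> carrier G \<and>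
      (\<forall>x \<in> set xs. \<forall>y \<in> set xs. x \<otimes>\<^bsub>G\<^esub> y = y \<otimes>\<^bsub>G\<^esub> x)}"

definition conj_tuple :: "('a, 'b) monoid_scheme \<Rightarrow> 'a \<Rightarrow> 'a list \<Rightarrow> 'a list" where
  "conj_tuple G g xs = map (\<lambda>x. g \<otimes>\<^bsub>G\<^esub> x \<otimes>\<^bsub>G\<^esub> inv\<^bsub>G\<^esub> g) xs"

definition beta :: "('a, 'b) monoid_scheme \<Rightarrow> nat \<Rightarrow> nat" where
  "beta G n = card ((\<lambda>xs. (\<lambda>g. conj_tuple G g xs) ` carrier G) ` commuting_tuples G n)"

definition B_series :: "('a, 'b) monoid_scheme \<Rightarrow> rat fps" where
  "B_series G = Abs_fps (\<lambda>n. of_nat (beta G n))"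

end

theory Submission
  imports Defs "HOL-Algebra.Group_Action"
begin

text \<open>
  Burnside's lemma gives \<open>beta n * |G| = c (n + 1)\<close>, where \<open>c n\<close> is the number of commuting
  \<open>n\<close>-tuples, so it suffices to compute \<open>c\<close>.  Let \<open>M\<close> be the abelian maximal subgroup in
  case (1) and \<open>P_1\<close> in case (2).  In both cases \<open>M\<close> centralizes \<open>gamma i / gamma (i + 2)\<close> for
  all \<open>i >= 2\<close>; since the factors \<open>gamma i / gamma (i + 1)\<close> have order \<open>p\<close>, an element \<open>x\<close>
  outside \<open>M\<close> centralizes nothing in \<open>M\<close> beyond the center \<open>gamma (m - 1)\<close>, and its
  centralizer is abelian of order \<open>p^2\<close>.  In case (2), \<open>gamma 3\<close> is central of index \<open>p^2\<close> in
  the nonabelian group \<open>P_1\<close>, so an element of \<open>P_1\<close> outside \<open>gamma 3\<close> has an abelian centralizer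
  of order \<open>p^(m-2)\<close> in \<open>P_1\<close>.  Thus for \<open>(S, T) = (G, M)\<close> and \<open>(P_1, gamma 3)\<close> the
  centralizers in \<open>S\<close> of elements of \<open>S - T\<close> are abelian of equal order and meet \<open>T\<close> in one
  fixed subgroup; the commuting tuples in \<open>S\<close> are then counted from those in \<open>T\<close>.
  Case (2) forces \<open>m >= 5\<close>, so all the exponents in the formula are nonnegative.
\<close>

section \<open>Commutators modulo a normal subgroup\<close>

text \<open>For normal \<open>N\<close> this is the preimage of the centralizer of the image of
  \<open>S\<close> in \<open>G Mod N\<close>. With \<open>N = {\<one>}\<close> it is the ordinary
  centralizer; with \<open>S = carrier G\<close> it is one step of the upper central series.\<close>

definition centralizer_mod :: "('a, 'b) monoid_scheme \<Rightarrow> 'a set \<Rightarrow> 'a set \<Rightarrow> 'a set" where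
  "centralizer_mod G N S = {g \<in> carrier G. \<forall>s \<in> S. commutator G g s \<in> N}"

lemma (in group) commutator_closed [simp]:
  "x \<in> carrier G \<Longrightarrow> y \<in> carrier G \<Longrightarrow> commutator G x y \<in> carrier G"
  by (simp add: commutator_def)

lemma (in group) inv_cancel_left:
  assumes "x \<in> carrier G" "y \<in> carrier G"
  shows "inv x \<otimes> (x \<otimes> y) = y" "x \<otimes> (inv x \<otimes> y) = y"
  using assms by (simp_all flip: m_assoc)

lemma (in group) commute_inv:
  assumes "x \<in> carrier G" "y \<in> carrier G" "x \<otimes> y = y \<otimes> x"
  shows "inv x \<otimes> y = y \<otimes> inv x"
proof -
  have "inv x \<otimes> y = inv x \<otimes> (y \<otimes> x) \<otimes> inv x" using assms by (simp add: m_assoc)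
  also have "\<dots> = y \<otimes> inv x"
    unfolding assms(3)[symmetric] using assms(1,2) by (simp add: inv_cancel_left)
  finally show ?thesis .
qed

lemma (in group) commutator_one_iff:
  assumes "x \<in> carrier G" "y \<in> carrier G"
  shows "commutator G x y = \<one> \<longleftrightarrow> x \<otimes> y = y \<otimes> x"
proof -
  have "commutator G x y = inv (y \<otimes> x) \<otimes> (x \<otimes> y)"
    using assms by (simp add: commutator_def inv_mult_group m_assoc)
  then show ?thesis
    using assms by (metis inv_closed inv_equality inv_inv m_closed r_inv)
qed

lemma (in group) commutator_inv:
  assumes "x \<in> carrier G" "y \<in> carrier G"
  shows "inv (commutator G x y) = commutator G y x"
  using assms by (simp add: commutator_def inv_mult_group m_assoc)

lemma (in group) commutator_conj:
  assumes "x \<in> carrier G" "y \<in> carrier G" "g \<in> carrier G"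
  shows "g \<otimes> commutator G x y \<otimes> inv g = commutator G (g \<otimes> x \<otimes> inv g) (g \<otimes> y \<otimes> inv g)"
  using assms
  by (simp add: commutator_def inv_mult_group m_assoc inv_cancel_left)

lemma (in group) commutator_mem_sym:
  assumes "subgroup N G" "x \<in> carrier G" "y \<in> carrier G"
  shows "commutator G x y \<in> N \<longleftrightarrow> commutator G y x \<in> N"
  using assms by (metis commutator_inv subgroup.m_inv_closed)

lemma (in normal) rcos_eq_iff:
  assumes "x \<in> carrier G" "y \<in> carrier G"
  shows "H #> x = H #> y \<longleftrightarrow> x \<otimes> inv y \<in> H"
  using assms by (metis is_subgroup repr_independence rcos_self rcos_module is_group)

lemma (in normal) conj_mem_iff:
  assumes "x \<in> carrier G" "y \<in> carrier G"
  shows "inv y \<otimes> x \<otimes> y \<in> H \<longleftrightarrow> x \<in> H"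
proof
  assume "inv y \<otimes> x \<otimes> y \<in> H"
  then have "y \<otimes> (inv y \<otimes> x \<otimes> y) \<otimes> inv y \<in> H"
    using assms by (intro inv_op_closed2)
  then show "x \<in> H" using assms by (simp add: m_assoc inv_cancel_left)
qed (use assms inv_op_closed1 in blast)

text \<open>The commutator is \<open>inv (y \<otimes> x) \<otimes> (x \<otimes> y)\<close>, a
  conjugate of \<open>(x \<otimes> y) \<otimes> inv (y \<otimes> x)\<close>, so a normal
  \<open>H\<close> contains both or neither. Facts about commuting elements of the quotient thus
  apply to commutators modulo \<open>H\<close>.\<close>

lemma (in normal) commutator_mem_iff:
  assumes "x \<in> carrier G" "y \<in> carrier G"
  shows "commutator G x y \<in> H \<longleftrightarrow>
    (H #> x) \<otimes>\<^bsub>G Mod H\<^esub> (H #> y) = (H #> y) \<otimes>\<^bsub>G Mod H\<^esub> (H #> x)"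
proof -
  have "(H #> x) \<otimes>\<^bsub>G Mod H\<^esub> (H #> y) = (H #> y) \<otimes>\<^bsub>G Mod H\<^esub> (H #> x)
      \<longleftrightarrow> (x \<otimes> y) \<otimes> inv (y \<otimes> x) \<in> H"
    using assms by (simp add: rcos_sum rcos_eq_iff)
  also have "\<dots> \<longleftrightarrow> inv (y \<otimes> x) \<otimes> ((x \<otimes> y) \<otimes> inv (y \<otimes> x)) \<otimes> (y \<otimes> x) \<in> H"
    using assms by (intro conj_mem_iff [symmetric]) auto
  also have "inv (y \<otimes> x) \<otimes> ((x \<otimes> y) \<otimes> inv (y \<otimes> x)) \<otimes> (y \<otimes> x) = commutator G x y"
    using assms by (simp add: commutator_def inv_mult_group m_assoc inv_cancel_left)
  finally show ?thesis by simp
qed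

text \<open>Closure under products and inverses is that of an ordinary centralizer in
  \<open>G Mod N\<close>, pulled back to \<open>G\<close>.\<close>

lemma (in group) centralizer_mod_subgroup:
  assumes "N \<lhd> G" "S \<subseteq> carrier G"
  shows "subgroup (centralizer_mod G N S) G"
proof -
  interpret N: normal N G by fact
  interpret Q: group "G Mod N" by (rule N.factorgroup_is_group)
  interpret q: group_hom G "G Mod N" "\<lambda>a. N #> a"
    by (simp add: group_hom_def group_hom_axioms_def N.r_coset_hom_Mod is_group Q.is_group)
  have mem: "g \<in> centralizer_mod G N S \<longleftrightarrow> g \<in> carrier G \<and>
      (\<forall>s\<in>S. (N #> g) \<otimes>\<^bsub>G Mod N\<^esub> (N #> s) = (N #> s) \<otimes>\<^bsub>G Mod N\<^esub> (N #> g))" for g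
    using assms(2) by (auto simp: centralizer_mod_def N.commutator_mem_iff subset_iff)
  show ?thesis
  proof (rule subgroupI)
    show "centralizer_mod G N S \<subseteq> carrier G" by (auto simp: centralizer_mod_def)
    have "\<one> \<in> centralizer_mod G N S"
      using assms(2) by (auto simp: mem simp del: one_FactGroup mult_FactGroup dest: subsetD)
    then show "centralizer_mod G N S \<noteq> {}" by blast
  next
    fix a assume a: "a \<in> centralizer_mod G N S"
    have "(N #> inv a) \<otimes>\<^bsub>G Mod N\<^esub> (N #> s) = (N #> s) \<otimes>\<^bsub>G Mod N\<^esub> (N #> inv a)"
      if "s \<in> S" for s
    proof -
      have "a \<in> carrier G" "s \<in> carrier G" and
        "(N #> a) \<otimes>\<^bsub>G Mod N\<^esub> (N #> s) = (N #> s) \<otimes>\<^bsub>G Mod N\<^esub> (N #> a)"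
        using a that assms(2) by (auto simp: mem)
      then show ?thesis
        using Q.commute_inv[of "N #> a" "N #> s"] q.hom_closed q.hom_inv[of a] by metis
    qed
    then show "inv a \<in> centralizer_mod G N S" using a by (auto simp: mem)
  next
    fix a b assume a: "a \<in> centralizer_mod G N S" and b: "b \<in> centralizer_mod G N S"
    have "(N #> (a \<otimes> b)) \<otimes>\<^bsub>G Mod N\<^esub> (N #> s) = (N #> s) \<otimes>\<^bsub>G Mod N\<^esub> (N #> (a \<otimes> b))"
      if "s \<in> S" for s
    proof -
      have "a \<in> carrier G" "b \<in> carrier G" "s \<in> carrier G" and
        "(N #> a) \<otimes>\<^bsub>G Mod N\<^esub> (N #> s) = (N #> s) \<otimes>\<^bsub>G Mod N\<^esub> (N #> a)"
        "(N #> b) \<otimes>\<^bsub>G Mod N\<^esub> (N #> s) = (N #> s) \<otimes>\<^bsub>G Mod N\<^esub> (N #> b)"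
        using a b that assms(2) by (auto simp: mem)
      then show ?thesis
        by (metis q.hom_closed q.hom_mult Q.m_assoc)
    qed
    then show "a \<otimes> b \<in> centralizer_mod G N S" using a b by (auto simp: mem)
  qed
qed

text \<open>Conjugation by \<open>x\<close> carries the commutator of \<open>h\<close> and
  \<open>inv x \<otimes> s \<otimes> x\<close> to that of
  \<open>x \<otimes> h \<otimes> inv x\<close> and \<open>s\<close>; normality of \<open>S\<close>
  keeps the conjugate of \<open>s\<close> inside \<open>S\<close>.\<close>

lemma (in group) centralizer_mod_normal:
  assumes "N \<lhd> G" "S \<lhd> G"
  shows "centralizer_mod G N S \<lhd> G"
proof (rule normal_invI)
  interpret N: normal N G by fact
  interpret S: normal S G by fact
  show "subgroup (centralizer_mod G N S) G"
    using assms(1) S.subset by (rule centralizer_mod_subgroup)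
  fix x h assume x: "x \<in> carrier G" and h: "h \<in> centralizer_mod G N S"
  have "commutator G (x \<otimes> h \<otimes> inv x) s \<in> N" if s: "s \<in> S" for s
  proof -
    have hc: "h \<in> carrier G" and sc: "s \<in> carrier G" using h s by (auto simp: centralizer_mod_def)
    have "commutator G h (inv x \<otimes> s \<otimes> x) \<in> N"
      using h S.inv_op_closed1[OF x s] by (auto simp: centralizer_mod_def)
    then have "x \<otimes> commutator G h (inv x \<otimes> s \<otimes> x) \<otimes> inv x \<in> N"
      by (rule N.inv_op_closed2[OF x])
    moreover have "x \<otimes> (inv x \<otimes> s \<otimes> x) \<otimes> inv x = s"
      using x sc by (simp add: m_assoc inv_cancel_left)
    ultimately show ?thesis using x hc sc by (simp add: commutator_conj)
  qed
  then show "x \<otimes> h \<otimes> inv x \<in> centralizer_mod G N S"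
    using x h by (auto simp: centralizer_mod_def)
qed

lemma (in group) centralizer_mod_swap:
  assumes "subgroup N G" "S \<subseteq> carrier G" "T \<subseteq> carrier G"
  shows "S \<subseteq> centralizer_mod G N T \<longleftrightarrow> T \<subseteq> centralizer_mod G N S"
  using assms commutator_mem_sym[OF assms(1)] unfolding centralizer_mod_def by blast

lemma (in group) subgroup_of_centralizer_mod:
  assumes "N \<lhd> G"
  shows "N \<subseteq> centralizer_mod G N (carrier G)"
proof
  interpret N: normal N G by fact
  fix n assume n: "n \<in> N"
  have "commutator G n g \<in> N" if "g \<in> carrier G" for g
    using n that N.inv_op_closed1[OF that, of n]
    by (simp add: commutator_def m_assoc N.m_closed)
  then show "n \<in> centralizer_mod G N (carrier G)"
    using n by (auto simp: centralizer_mod_def)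
qed

text \<open>A subgroup contains a generated subgroup once it contains the generators. Through this
  bridge, statements about commutator subgroups become statements about
  \<open>centralizer_mod\<close>.\<close>

lemma (in group) comm_subgroup_subset_iff:
  assumes "subgroup N G" "H \<subseteq> carrier G" "K \<subseteq> carrier G"
  shows "comm_subgroup G H K \<subseteq> N \<longleftrightarrow> H \<subseteq> centralizer_mod G N K"
proof
  assume "comm_subgroup G H K \<subseteq> N"
  then have "commutator G h k \<in> N" if "h \<in> H" "k \<in> K" for h k
    using that unfolding comm_subgroup_def by (blast intro: generate.incl)
  then show "H \<subseteq> centralizer_mod G N K"
    using assms by (auto simp: centralizer_mod_def)
next
  assume "H \<subseteq> centralizer_mod G N K"
  then show "comm_subgroup G H K \<subseteq> N"
    unfolding comm_subgroup_def using assms(1)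
    by (intro generate_subgroup_incl) (auto simp: centralizer_mod_def)
qed

lemma (in group) comm_subgroup_normal:
  assumes "H \<lhd> G" "K \<lhd> G"
  shows "comm_subgroup G H K \<lhd> G"
  unfolding comm_subgroup_def
proof (rule normal_generateI)
  interpret H: normal H G by fact
  interpret K: normal K G by fact
  show "{commutator G h k |h k. h \<in> H \<and> k \<in> K} \<subseteq> carrier G"
    by (auto intro: commutator_closed)
  fix c g assume c: "c \<in> {commutator G h k |h k. h \<in> H \<and> k \<in> K}" and g: "g \<in> carrier G"
  then obtain h k where "h \<in> H" "k \<in> K" "c = commutator G h k" by blast
  then have "g \<otimes> c \<otimes> inv g = commutator G (g \<otimes> h \<otimes> inv g) (g \<otimes> k \<otimes> inv g)"
    "g \<otimes> h \<otimes> inv g \<in> H" "g \<otimes> k \<otimes> inv g \<in> K"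
    using g by (auto simp: commutator_conj H.inv_op_closed2 K.inv_op_closed2)
  then show "g \<otimes> c \<otimes> inv g \<in> {commutator G h k |h k. h \<in> H \<and> k \<in> K}" by blast
qed

section \<open>The lower central series and centralizers modulo normal subgroups\<close>

lemma (in group) lower_central_normal: "lower_central G i \<lhd> G"
  by (induction i rule: induct_nat_012) (simp_all add: normal_self comm_subgroup_normal)

lemma (in group) lower_central_subgroup: "subgroup (lower_central G i) G"
  using lower_central_normal by (rule normal_imp_subgroup)

lemma (in group) lower_central_subset: "lower_central G i \<subseteq> carrier G"
  using lower_central_subgroup by (rule subgroup.subset)

lemma (in group) lower_central_Suc_subset_iff:
  assumes "subgroup N G" "1 \<le> i"
  shows "lower_central G (Suc i) \<subseteq> N \<longleftrightarrow>
    lower_central G i \<subseteq> centralizer_mod G N (carrier G)"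
  using assms comm_subgroup_subset_iff[OF assms(1) lower_central_subset[of i] subset_refl]
  by (cases i) auto

lemma (in group) lower_central_Suc_subset: "lower_central G (Suc i) \<subseteq> lower_central G i"
proof (cases "i = 0")
  case False
  then show ?thesis
    using lower_central_Suc_subset_iff[OF lower_central_subgroup, of i i]
      subgroup_of_centralizer_mod[OF lower_central_normal, of i] by simp
qed (simp add: lower_central_subset)

lemma (in group) lower_central_antimono:
  "i \<le> j \<Longrightarrow> lower_central G j \<subseteq> lower_central G i"
  using lower_central_Suc_subset by (rule lift_Suc_antimono_le)

lemma (in group) centralizer_mod_mono:
  "N \<subseteq> N' \<Longrightarrow> S' \<subseteq> S \<Longrightarrow> centralizer_mod G N S \<subseteq> centralizer_mod G N' S'"
  by (auto simp: centralizer_mod_def)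

lemma (in group) centralizer_mod_self:
  assumes "N \<lhd> G" "x \<in> carrier G"
  shows "x \<in> centralizer_mod G N {x}"
  using assms subgroup.one_closed[OF normal_imp_subgroup[OF assms(1)]]
  by (simp add: centralizer_mod_def iffD2[OF commutator_one_iff])

text \<open>An element of \<open>K\<close> outside \<open>H\<close> centralizes \<open>H\<close> and itself, hence \<open>K\<close>, so the center of
  \<open>K\<close> modulo \<open>N\<close> is larger than \<open>H\<close>.\<close>

lemma (in group) centralizer_mod_extend:
  assumes "N \<lhd> G" "subgroup H G" "subgroup K G" "H \<subseteq> K"
    and max: "\<And>L. subgroup L G \<Longrightarrow> H \<subseteq> L \<Longrightarrow> L \<subseteq> K \<Longrightarrow> L = H \<or> L = K"
    and H: "H \<subseteq> centralizer_mod G N K"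
  shows "K \<subseteq> centralizer_mod G N K"
proof (cases "H = K")
  case False
  then obtain x where x: "x \<in> K" "x \<notin> H" using assms(4) by blast
  have K: "K \<subseteq> carrier G" using assms(3) by (rule subgroup.subset)
  have N: "subgroup N G" using assms(1) by (rule normal_imp_subgroup)
  have xG: "{x} \<subseteq> carrier G" and HG: "H \<subseteq> carrier G" using x K assms(4) by auto
  have "H \<subseteq> centralizer_mod G N {x}"
    using H x(1) centralizer_mod_mono[of N N "{x}" K] by blast
  moreover have "x \<in> centralizer_mod G N {x}"
    using assms(1) xG by (intro centralizer_mod_self) auto
  moreover have "subgroup (centralizer_mod G N {x} \<inter> K) G"
    using centralizer_mod_subgroup[OF assms(1) xG] assms(3) by (rule subgroups_Inter_pair)
  ultimately have "centralizer_mod G N {x} \<inter> K = K"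
    using max[of "centralizer_mod G N {x} \<inter> K"] x assms(4) by blast
  then have "K \<subseteq> centralizer_mod G N {x}" by blast
  then have "{x} \<subseteq> centralizer_mod G N K"
    using centralizer_mod_swap[OF N K xG] by simp
  moreover have "subgroup (centralizer_mod G N K \<inter> K) G"
    using centralizer_mod_subgroup[OF assms(1) K] assms(3) by (rule subgroups_Inter_pair)
  ultimately show ?thesis
    using max[of "centralizer_mod G N K \<inter> K"] x assms(4) H by blast
qed (use H in auto)

section \<open>Order inequalities obtained by counting fibers\<close>

lemma card_le_fibers:
  assumes "finite B" "f ` A \<subseteq> B" "\<And>b. b \<in> B \<Longrightarrow> card {a \<in> A. f a = b} \<le> k"
  shows "card A \<le> card B * k"
proof -
  have "card A = card (\<Union>b\<in>B. {a \<in> A. f a = b})"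
    using assms(2) by (intro arg_cong[of _ _ card]) auto
  also have "\<dots> \<le> (\<Sum>b\<in>B. card {a \<in> A. f a = b})"
    using assms(1) by (rule card_UN_le)
  also have "\<dots> \<le> card B * k"
    using sum_bounded_above[of B "\<lambda>b. card {a \<in> A. f a = b}" k] assms(3) by simp
  finally show ?thesis .
qed

text \<open>Each nonempty fiber of the product map on \<open>H \<times> K\<close> injects into
  \<open>H \<inter> K\<close>: relative to a base point \<open>(h0, k0)\<close>, the pair
  \<open>(h, k)\<close> goes to \<open>inv h0 \<otimes> h\<close>, which equals
  \<open>k0 \<otimes> inv k\<close>.\<close>

lemma (in group) card_mult_le:
  assumes H: "subgroup H G" and K: "subgroup K G" and fin: "finite (carrier G)"
  shows "card H * card K \<le> order G * card (H \<inter> K)"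
proof -
  have HG: "H \<subseteq> carrier G" and KG: "K \<subseteq> carrier G"
    using H K by (auto dest: subgroup.subset)
  have "card (H \<times> K) \<le> card (carrier G) * card (H \<inter> K)"
  proof (rule card_le_fibers[OF fin])
    show "(\<lambda>(h, k). h \<otimes> k) ` (H \<times> K) \<subseteq> carrier G" using HG KG by auto
    fix b assume "b \<in> carrier G"
    show "card {a \<in> H \<times> K. (\<lambda>(h, k). h \<otimes> k) a = b} \<le> card (H \<inter> K)"
    proof (cases "{a \<in> H \<times> K. (\<lambda>(h, k). h \<otimes> k) a = b} = {}")
      case False
      then obtain h0 k0 where h0: "h0 \<in> H" "k0 \<in> K" "h0 \<otimes> k0 = b" by auto
      show ?thesis
      proof (rule card_inj_on_le)
        show "finite (H \<inter> K)" using fin HG finite_subset by blast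
        show "inj_on (\<lambda>(h, k). inv h0 \<otimes> h) {a \<in> H \<times> K. (\<lambda>(h, k). h \<otimes> k) a = b}"
        proof (rule inj_onI, clarsimp)
          fix h k h' k'
          assume a: "h \<in> H" "k \<in> K" "h' \<in> H" "k' \<in> K" "h' \<otimes> k' = h \<otimes> k"
            "inv h0 \<otimes> h = inv h0 \<otimes> h'"
          then have "h \<in> carrier G" "h' \<in> carrier G" "k \<in> carrier G" "k' \<in> carrier G" "h0 \<in> carrier G"
            using HG KG h0 by auto
          then show "h = h' \<and> k = k'" using a by simp
        qed
        show "(\<lambda>(h, k). inv h0 \<otimes> h) ` {a \<in> H \<times> K. (\<lambda>(h, k). h \<otimes> k) a = b} \<subseteq> H \<inter> K"
        proof
          fix z assume "z \<in> (\<lambda>(h, k). inv h0 \<otimes> h) ` {a \<in> H \<times> K. (\<lambda>(h, k). h \<otimes> k) a = b}"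
          then obtain h k where z: "z = inv h0 \<otimes> h" and a: "h \<in> H" "k \<in> K" "b = h \<otimes> k" by auto
          then have c: "h \<in> carrier G" "k \<in> carrier G" "h0 \<in> carrier G" "k0 \<in> carrier G"
            using HG KG h0 by auto
          have "inv h0 \<otimes> h = k0 \<otimes> inv k"
            using a(3) h0(3) c by (metis inv_closed inv_solve_left inv_solve_right m_assoc m_closed)
          moreover have "inv h0 \<otimes> h \<in> H" "k0 \<otimes> inv k \<in> K"
            using a h0 by (auto intro: subgroup.m_closed[OF H] subgroup.m_closed[OF K]
                subgroup.m_inv_closed[OF H] subgroup.m_inv_closed[OF K])
          ultimately show "z \<in> H \<inter> K" using z by simp
        qed
      qed
    qed (simp only: card.empty le0)
  qed
  then show ?thesis by (simp add: order_def card_cartesian_product)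
qed

text \<open>If the commutators of \<open>s\<close> with \<open>g\<close> and with \<open>g0\<close>
  lie in the same coset of \<open>N\<close>, then \<open>g \<otimes> inv g0\<close> centralizes
  \<open>s\<close> modulo \<open>N\<close>. So the index of this centralizer is at most that of
  \<open>N\<close> in \<open>K\<close>. Pairing \<open>g\<close> with an element of \<open>N\<close>
  counts cosets without forming a quotient.\<close>

lemma (in group) card_commutator_fibers:
  assumes N: "N \<lhd> G" and K: "subgroup K G" and fin: "finite (carrier G)"
    and s: "s \<in> carrier G" and NK: "N \<subseteq> K" and sK: "\<And>g. g \<in> carrier G \<Longrightarrow> commutator G s g \<in> K"
  shows "order G * card N \<le> card K * card (centralizer_mod G N {s})"
proof -
  interpret N: normal N G by fact
  have KG: "K \<subseteq> carrier G" using K by (rule subgroup.subset)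
  let ?f = "\<lambda>(g, c). commutator G s g \<otimes> c"
  have "card (carrier G \<times> N) \<le> card K * card (centralizer_mod G N {s})"
  proof (rule card_le_fibers)
    show "finite K" using fin KG by (rule finite_subset[rotated])
    show "?f ` (carrier G \<times> N) \<subseteq> K"
      using NK sK subgroup.m_closed[OF K] by auto
    fix b assume "b \<in> K"
    show "card {a \<in> carrier G \<times> N. ?f a = b} \<le> card (centralizer_mod G N {s})"
    proof (cases "{a \<in> carrier G \<times> N. ?f a = b} = {}")
      case False
      then obtain g0 c0 where g0: "g0 \<in> carrier G" "c0 \<in> N" "commutator G s g0 \<otimes> c0 = b" by auto
      show ?thesis
      proof (rule card_inj_on_le)
        show "finite (centralizer_mod G N {s})" using fin by (simp add: centralizer_mod_def)
        show "inj_on (\<lambda>(g, c). g \<otimes> inv g0) {a \<in> carrier G \<times> N. ?f a = b}"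
        proof (rule inj_onI, clarsimp)
          fix g c g' c'
          assume a: "g \<in> carrier G" "c \<in> N" "g' \<in> carrier G" "c' \<in> N"
            "commutator G s g' \<otimes> c' = commutator G s g \<otimes> c" "g \<otimes> inv g0 = g' \<otimes> inv g0"
          then have "g = g'" using g0 by simp
          then show "g = g' \<and> c = c'" using a s by simp
        qed
        show "(\<lambda>(g, c). g \<otimes> inv g0) ` {a \<in> carrier G \<times> N. ?f a = b} \<subseteq> centralizer_mod G N {s}"
        proof
          fix z assume "z \<in> (\<lambda>(g, c). g \<otimes> inv g0) ` {a \<in> carrier G \<times> N. ?f a = b}"
          then obtain g c where z: "z = g \<otimes> inv g0"
            and a: "g \<in> carrier G" "c \<in> N" "b = commutator G s g \<otimes> c" by auto
          then have cG: "c \<in> carrier G" "c0 \<in> carrier G" using g0 by auto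
          have "commutator G s g \<otimes> c = commutator G s g0 \<otimes> c0" using a g0 by simp
          then have "commutator G s g = commutator G s g0 \<otimes> c0 \<otimes> inv c"
            using a(1) g0(1) s cG by (simp add: inv_solve_right)
          \<comment> \<open>Multiplication by \<open>s\<close> turns the commutator into the
            conjugate \<open>inv g \<otimes> s \<otimes> g\<close>, which can then be conjugated
            back by \<open>g0\<close>.\<close>
          then have "s \<otimes> commutator G s g = s \<otimes> (commutator G s g0 \<otimes> (c0 \<otimes> inv c))"
            using a(1) g0(1) s cG by (simp add: m_assoc)
          then have conj: "inv g \<otimes> s \<otimes> g = inv g0 \<otimes> s \<otimes> g0 \<otimes> (c0 \<otimes> inv c)"
            using a(1) g0(1) s cG by (simp add: commutator_def m_assoc inv_cancel_left)
          have "commutator G s (g \<otimes> inv g0) = inv s \<otimes> (g0 \<otimes> (inv g \<otimes> s \<otimes> g) \<otimes> inv g0)"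
            using a(1) g0(1) s by (simp add: commutator_def m_assoc inv_mult_group)
          also have "\<dots> = g0 \<otimes> (c0 \<otimes> inv c) \<otimes> inv g0"
            unfolding conj using a(1) g0(1) s cG by (simp add: m_assoc inv_cancel_left)
          also have "\<dots> \<in> N"
            using a(2) g0 by (intro N.inv_op_closed2) auto
          finally have "commutator G (g \<otimes> inv g0) s \<in> N"
            using commutator_mem_sym[OF N.is_subgroup s, of "g \<otimes> inv g0"] a(1) g0(1) by simp
          then show "z \<in> centralizer_mod G N {s}"
            using a(1) g0(1) z by (simp add: centralizer_mod_def)
        qed
      qed
    qed (simp only: card.empty le0)
  qed
  then show ?thesis by (simp add: order_def card_cartesian_product)
qed

section \<open>Groups of prime power order\<close>

locale prime_power_group = group G for G (structure) +
  fixes p m :: nat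
  assumes prime: "prime p" and order: "order G = p ^ m"
begin

lemma p_gt_1: "p > 1"
  using prime by (rule prime_gt_1_nat)

lemma finite_carrier: "finite (carrier G)"
  using order p_gt_1 by (intro card_ge_0_finite) (simp add: order_def)

lemma finite_subgroup: "subgroup H G \<Longrightarrow> finite H"
  using finite_carrier subgroup.subset finite_subset by metis

lemma subgroup_card:
  assumes "subgroup H G"
  obtains k where "card H = p ^ k"
proof -
  have "card H dvd p ^ m" using lagrange[OF assms] by (metis dvd_triv_right order)
  then show ?thesis using that divides_primepow_nat[OF prime] by blast
qed

lemma subgroup_psubset_card:
  assumes "subgroup H G" "subgroup K G" "H \<subset> K"
  shows "p * card H \<le> card K"
proof -
  obtain a b where ab: "card H = p ^ a" "card K = p ^ b"
    using subgroup_card assms by metis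
  moreover have "card H < card K"
    using assms(3) finite_subgroup[OF assms(2)] by (intro psubset_card_mono)
  ultimately have "a < b" using p_gt_1 by (simp add: power_strict_increasing_iff)
  then show ?thesis
    using ab p_gt_1 power_increasing[of "Suc a" b p] by simp
qed

text \<open>A strict chain \<open>H \<subset> L \<subset> K\<close> would contribute the factor
  \<open>p\<close> twice.\<close>

lemma subgroup_between:
  assumes "subgroup H G" "subgroup K G" "subgroup L G" "H \<subseteq> L" "L \<subseteq> K" "card K = p * card H"
  shows "L = H \<or> L = K"
proof (rule ccontr)
  assume neq: "\<not> (L = H \<or> L = K)"
  then have "p * card H \<le> card L" using assms by (intro subgroup_psubset_card) auto
  moreover have "p * card L \<le> card K" using assms neq by (intro subgroup_psubset_card) auto
  moreover have "card L > 0"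
    using finite_subgroup[OF assms(3)] subgroup.one_closed[OF assms(3)] card_gt_0_iff by blast
  ultimately have "card L > 0" "p * card L \<le> card L" using assms(6) by linarith+
  then show False using p_gt_1 by simp
qed

lemma centralizer_mod_extend_card:
  assumes "N \<lhd> G" "subgroup H G" "subgroup K G" "H \<subseteq> K" "card K = p * card H"
    and "H \<subseteq> centralizer_mod G N K"
  shows "K \<subseteq> centralizer_mod G N K"
  using assms(1-4) subgroup_between[OF assms(2,3) _ _ _ assms(5)] assms(6)
  by (rule centralizer_mod_extend)

lemma maximal_subgroupI_card:
  assumes "subgroup H G" "p * card H = order G"
  shows "maximal_subgroup H G"
proof -
  have "H \<noteq> carrier G"
    using assms(2) order p_gt_1 by (auto simp: order_def)
  then show ?thesis
    using assms subgroup_between[OF assms(1) subgroup_self] subgroup.subset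
    unfolding maximal_subgroup_def by (auto simp: order_def)
qed

text \<open>Class equation: if only \<open>\<one>\<close> were central, every other conjugacy class
  would have size a positive power of \<open>p\<close>, so \<open>p ^ m\<close> would be 1 plus a
  multiple of \<open>p\<close>.\<close>

lemma nontrivial_center:
  assumes "carrier G \<noteq> {\<one>}"
  obtains z where "z \<in> carrier G" "z \<noteq> \<one>" "\<And>g. g \<in> carrier G \<Longrightarrow> z \<otimes> g = g \<otimes> z"
proof (rule ccontr)
  note center = that
  assume "\<not> thesis"
  then have triv: "z = \<one>" if "z \<in> carrier G" "\<forall>g \<in> carrier G. z \<otimes> g = g \<otimes> z" for z
    using center[of z] that by blast
  let ?phi = "\<lambda>g. \<lambda>h \<in> carrier G. g \<otimes> h \<otimes> inv g"
  interpret act: group_action G "carrier G" ?phi by (rule action_by_conjugation)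
  have "orbit G ?phi \<one> \<subseteq> {\<one>}" by (auto simp: orbit_def)
  then have orb_one: "orbit G ?phi \<one> = {\<one>}" using act.orbit_refl[OF one_closed] by blast
  have dvd: "p dvd card (orbit G ?phi x)" if x: "x \<in> carrier G" "x \<noteq> \<one>" for x
  proof -
    have "card (orbit G ?phi x) dvd p ^ m"
      unfolding order[symmetric] act.orbit_stabilizer_theorem[OF x(1), symmetric] by simp
    then obtain k where k: "card (orbit G ?phi x) = p ^ k"
      using divides_primepow_nat[OF prime] by blast
    have "k \<noteq> 0"
    proof
      assume "k = 0"
      then obtain y where "orbit G ?phi x = {y}" using k card_1_singletonE[of "orbit G ?phi x"] by auto
      then have orb: "orbit G ?phi x = {x}" using act.orbit_refl[OF x(1)] by simp
      have "x \<otimes> g = g \<otimes> x" if g: "g \<in> carrier G" for g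
      proof -
        have "?phi g x \<in> orbit G ?phi x" using g unfolding orbit_def by blast
        then have "g \<otimes> x \<otimes> inv g = x" using orb x by simp
        then show ?thesis using x g by (metis inv_solve_right m_closed)
      qed
      then show False using triv x by blast
    qed
    then show ?thesis using k by simp
  qed
  have fin: "finite (carrier G)" by (rule finite_carrier)
  have "card (carrier G) = (\<Sum>R \<in> orbits G (carrier G) ?phi. card R)"
    using act.disjoint_sum[OF fin, of "\<lambda>_. 1::nat"] by simp
  also have "\<dots> = card (orbit G ?phi \<one>) + (\<Sum>R \<in> orbits G (carrier G) ?phi - {orbit G ?phi \<one>}. card R)"
  proof (rule sum.remove)
    show "finite (orbits G (carrier G) ?phi)"
      using fin unfolding orbits_def by (auto simp: setcompr_eq_image)
  qed (auto simp: orbits_def)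
  finally have eq: "p ^ m = 1 + (\<Sum>R \<in> orbits G (carrier G) ?phi - {orbit G ?phi \<one>}. card R)"
    using order orb_one by (simp add: order_def)
  have S: "p dvd (\<Sum>R \<in> orbits G (carrier G) ?phi - {orbit G ?phi \<one>}. card R)"
    using dvd by (intro dvd_sum) (auto simp: orbits_def)
  have "p dvd p ^ m"
  proof -
    have "m \<noteq> 0"
    proof
      assume "m = 0"
      then have "card (carrier G) = 1" using order by (simp add: order_def)
      then show False using assms by (metis card_1_singletonE one_closed singletonD)
    qed
    then show ?thesis by simp
  qed
  then have "p dvd 1" unfolding eq dvd_add_left_iff[OF S] .
  then show False using p_gt_1 by simp
qed

end

section \<open>Nilpotency of groups of prime power order\<close>

text \<open>The quotient is again of prime power order, so it has a nontrivial central element; any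
  representative of it lies in the centralizer but not in \<open>N\<close>.\<close>

lemma (in prime_power_group) centralizer_mod_psubset:
  assumes "N \<lhd> G" "N \<noteq> carrier G"
  shows "N \<subset> centralizer_mod G N (carrier G)"
proof -
  interpret N: normal N G by fact
  have "card (rcosets N) dvd p ^ m"
    unfolding order[symmetric] lagrange[OF N.is_subgroup, symmetric] by simp
  then obtain k where k: "order (G Mod N) = p ^ k"
    using divides_primepow_nat[OF prime] by (auto simp: order_def FactGroup_def)
  interpret Q: prime_power_group "G Mod N" p k
    using N.factorgroup_is_group prime k
    by (simp add: prime_power_group_def prime_power_group_axioms_def)
  have "carrier (G Mod N) \<noteq> {\<one>\<^bsub>G Mod N\<^esub>}"
  proof
    assume *: "carrier (G Mod N) = {\<one>\<^bsub>G Mod N\<^esub>}"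
    have "x \<in> N" if "x \<in> carrier G" for x
    proof -
      have "N #> x \<in> carrier (G Mod N)" using that by (auto simp: FactGroup_def RCOSETS_def)
      then have "N #> x = N" unfolding * by simp
      then show ?thesis using rcos_self[OF that N.is_subgroup] by simp
    qed
    then show False using assms(2) N.subset by blast
  qed
  then obtain Z where Z: "Z \<in> carrier (G Mod N)" "Z \<noteq> \<one>\<^bsub>G Mod N\<^esub>"
    "\<And>g. g \<in> carrier (G Mod N) \<Longrightarrow> Z \<otimes>\<^bsub>G Mod N\<^esub> g = g \<otimes>\<^bsub>G Mod N\<^esub> Z"
    using Q.nontrivial_center by blast
  then obtain z where z: "z \<in> carrier G" "Z = N #> z"
    by (auto simp: FactGroup_def RCOSETS_def)
  have "commutator G z g \<in> N" if "g \<in> carrier G" for g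
  proof -
    have "N #> g \<in> carrier (G Mod N)" using that by (auto simp: FactGroup_def RCOSETS_def)
    then show ?thesis using Z(3) z that by (simp add: N.commutator_mem_iff del: mult_FactGroup)
  qed
  then have "z \<in> centralizer_mod G N (carrier G)"
    using z by (simp add: centralizer_mod_def)
  moreover have "z \<notin> N" using Z(2) z N.rcos_const by auto
  ultimately show ?thesis using subgroup_of_centralizer_mod[OF assms(1)] by blast
qed

text \<open>The upper central series climbs to \<open>G\<close>, and the lower central series
  descends below it. This supplies the witness for the \<open>LEAST\<close> in
  \<open>nilpotency_class\<close>.\<close>

lemma (in prime_power_group) lower_central_terminates:
  "\<exists>c. lower_central G (Suc c) = {\<one>}"
proof -
  define Z where "Z i = ((\<lambda>N. centralizer_mod G N (carrier G)) ^^ i) {\<one>}" for i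
  have Z_Suc: "Z (Suc i) = centralizer_mod G (Z i) (carrier G)" for i by (simp add: Z_def)
  have Z_normal: "Z i \<lhd> G" for i
  proof (induction i)
    case 0
    show ?case by (simp add: Z_def one_is_normal)
  next
    case (Suc i)
    then show ?case by (simp add: Z_Suc normal_self centralizer_mod_normal)
  qed
  have Z_card: "Z i = carrier G \<or> i < card (Z i)" for i
  proof (induction i)
    case (Suc i)
    have sub: "Z (Suc i) \<subseteq> carrier G" using Z_normal normal_imp_subgroup subgroup.subset by blast
    show ?case
    proof (cases "Z i = carrier G")
      case True
      then show ?thesis
        using subgroup_of_centralizer_mod[OF Z_normal[of i]] sub by (auto simp: Z_Suc)
    next
      case False
      then have "Z i \<subset> Z (Suc i)" using centralizer_mod_psubset[OF Z_normal] by (simp add: Z_Suc)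
      then have "card (Z i) < card (Z (Suc i))"
        using sub finite_carrier by (meson finite_subset psubset_card_mono)
      then show ?thesis using Suc False by simp
    qed
  qed (simp add: Z_def)
  \<comment> \<open>Every strict step of \<open>Z\<close> adds at least one element, so
    \<open>order G\<close> steps suffice.\<close>
  define c where "c = order G"
  have "card (Z c) \<le> c"
    unfolding c_def order_def using Z_normal normal_imp_subgroup subgroup.subset finite_carrier
    by (metis card_mono)
  then have top: "Z c = carrier G" using Z_card[of c] by simp
  \<comment> \<open>The two series are matched from the top: index 1 of the lower one faces
    \<open>Z c\<close>.\<close>
  have "lower_central G (Suc i) \<subseteq> Z (c - i)" if "i \<le> c" for i
    using that
  proof (induction i)
    case (Suc i)
    then have "Z (c - i) = centralizer_mod G (Z (c - Suc i)) (carrier G)"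
      by (metis Suc_diff_le diff_Suc_Suc Z_Suc)
    then show ?case
      using Suc by (subst lower_central_Suc_subset_iff) (auto intro: normal_imp_subgroup Z_normal)
  qed (simp add: top)
  from this[of c] have "lower_central G (Suc c) \<subseteq> {\<one>}" by (simp add: Z_def)
  then have "lower_central G (Suc c) = {\<one>}"
    using subgroup.one_closed[OF lower_central_subgroup] by blast
  then show ?thesis by blast
qed

section \<open>Groups of maximal class\<close>

locale maximal_class_group = prime_power_group +
  assumes m_ge_4: "4 \<le> m" and class_eq: "nilpotency_class G = m - 1"
begin

abbreviation gamma :: "nat \<Rightarrow> 'a set" where
  "gamma \<equiv> lower_central G"

lemma gamma_m: "gamma m = {\<one>}"
proof -
  have "gamma (Suc (nilpotency_class G)) = {\<one>}"
    unfolding nilpotency_class_def by (rule LeastI_ex) (rule lower_central_terminates)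
  then show ?thesis using class_eq m_ge_4 by simp
qed

lemma gamma_nontrivial:
  assumes "1 \<le> i" "i < m"
  shows "gamma i \<noteq> {\<one>}"
proof -
  have "i - 1 < nilpotency_class G" using assms class_eq by simp
  then have "gamma (Suc (i - 1)) \<noteq> {\<one>}"
    unfolding nilpotency_class_def by (rule not_less_Least)
  then show ?thesis using assms by simp
qed

text \<open>Two equal consecutive terms would make the series constant from there on, although it
  reaches \<open>{\<one>}\<close> at \<open>m\<close> and not before.\<close>

lemma gamma_Suc_neq:
  assumes "1 \<le> i" "i < m"
  shows "gamma (Suc i) \<noteq> gamma i"
proof
  assume eq: "gamma (Suc i) = gamma i"
  have "gamma (i + k) = gamma i" for k
  proof (induction k)
    case (Suc k)
    have "gamma (Suc (i + k)) = comm_subgroup G (gamma (i + k)) (carrier G)"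
      using assms(1) by (cases "i + k") auto
    also have "\<dots> = comm_subgroup G (gamma i) (carrier G)" by (simp add: Suc)
    also have "\<dots> = gamma (Suc i)" using assms(1) by (cases i) auto
    finally show ?case using eq by simp
  qed simp
  from this[of "m - i"] have "gamma m = gamma i" using assms by simp
  then show False using gamma_nontrivial[OF assms] gamma_m by simp
qed

lemma gamma_psubset: "1 \<le> i \<Longrightarrow> i < m \<Longrightarrow> gamma (Suc i) \<subset> gamma i"
  using gamma_Suc_neq lower_central_Suc_subset by blast

text \<open>Centrality would mean that \<open>gamma (Suc i)\<close> lies in
  \<open>gamma (Suc (Suc i))\<close>, against strict descent.\<close>

lemma gamma_not_central_mod:
  assumes "1 \<le> i" "Suc i < m"
  shows "\<not> gamma i \<subseteq> centralizer_mod G (gamma (Suc (Suc i))) (carrier G)"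
  using lower_central_Suc_subset_iff[OF lower_central_subgroup assms(1)] gamma_psubset[of "Suc i"] assms
  by (metis le_SucI less_le_not_le)

lemma card_gamma_ge: "1 \<le> i \<Longrightarrow> i \<le> m \<Longrightarrow> p ^ (m - i) \<le> card (gamma i)"
proof (induction "m - i" arbitrary: i)
  case 0
  then show ?case using gamma_m by simp
next
  case (Suc k)
  then have "p ^ (m - Suc i) \<le> card (gamma (Suc i))" by (intro Suc.hyps) auto
  moreover have "p * card (gamma (Suc i)) \<le> card (gamma i)"
    using Suc.hyps(2) Suc.prems
    by (intro subgroup_psubset_card lower_central_subgroup gamma_psubset) auto
  moreover have "p ^ (m - i) = p * p ^ (m - Suc i)"
    using Suc.hyps(2) by (simp flip: power_Suc add: Suc_diff_Suc)
  ultimately show ?case by (metis le_trans mult_le_mono2)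
qed

lemma gamma_2_subset_iff: "subgroup N G \<Longrightarrow>
    gamma 2 \<subseteq> N \<longleftrightarrow> centralizer_mod G N (carrier G) = carrier G"
  using lower_central_Suc_subset_iff[of N 1]
  by (auto simp: numeral_2_eq_2 centralizer_mod_def)

text \<open>A maximal subgroup and one element outside it generate \<open>G\<close>, so if
  \<open>M\<close> were central modulo \<open>gamma 3\<close>, the quotient by
  \<open>gamma 3\<close> would be abelian and \<open>gamma 2\<close> would lie in
  \<open>gamma 3\<close>.\<close>

lemma maximal_not_central_mod:
  assumes "maximal_subgroup M G"
  shows "\<not> M \<subseteq> centralizer_mod G (gamma 3) (carrier G)"
proof
  assume "M \<subseteq> centralizer_mod G (gamma 3) (carrier G)"
  then have "carrier G \<subseteq> centralizer_mod G (gamma 3) (carrier G)"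
    using assms unfolding maximal_subgroup_def
    by (intro centralizer_mod_extend[of "gamma 3" M "carrier G"] lower_central_normal subgroup_self)
       (auto dest: subgroup.subset)
  then have "gamma 2 \<subseteq> gamma 3"
    using gamma_2_subset_iff[OF lower_central_subgroup] by (auto simp: centralizer_mod_def)
  then show False
    using gamma_psubset[of 2] m_ge_4 by (auto simp: numeral_3_eq_3 numeral_2_eq_2)
qed

lemma gamma_central_mod: "1 \<le> i \<Longrightarrow> gamma i \<subseteq> centralizer_mod G (gamma (Suc i)) (carrier G)"
  using lower_central_Suc_subset_iff[OF lower_central_subgroup] by blast

lemma gamma_2_not_maximal: "\<not> maximal_subgroup (gamma 2) G"
  using maximal_not_central_mod gamma_central_mod[of 2] by (auto simp: numeral_3_eq_3 numeral_2_eq_2)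

text \<open>The index of \<open>gamma 2\<close> is not \<open>p\<close>, since
  \<open>gamma 2\<close> would then be maximal; hence it is at least \<open>p ^ 2\<close>. Each
  later strict step divides the order by at least \<open>p\<close>.\<close>

lemma card_gamma_le: "2 \<le> i \<Longrightarrow> i \<le> m \<Longrightarrow> card (gamma i) \<le> p ^ (m - i)"
proof (induction i rule: dec_induct)
  case base
  obtain k where k: "card (gamma 2) = p ^ k"
    using subgroup_card lower_central_subgroup by blast
  have "gamma 2 \<subset> carrier G"
    using gamma_psubset[of 1] m_ge_4 by (simp add: numeral_2_eq_2)
  then have "p * p ^ k \<le> p ^ m"
    using subgroup_psubset_card[OF lower_central_subgroup subgroup_self] k order
    by (metis order_def)
  then have "Suc k \<le> m"
    using p_gt_1 power_increasing_iff[of p "Suc k" m] by simp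
  moreover have "Suc k \<noteq> m"
    using maximal_subgroupI_card[OF lower_central_subgroup[of 2]] gamma_2_not_maximal k order by auto
  ultimately show ?case using k p_gt_1 m_ge_4 by (simp add: power_increasing)
next
  case (step n)
  then have "p * card (gamma (Suc n)) \<le> card (gamma n)"
    by (intro subgroup_psubset_card lower_central_subgroup gamma_psubset) auto
  also have "\<dots> \<le> p ^ (m - n)" using step by simp
  also have "p ^ (m - n) = p * p ^ (m - Suc n)"
    using step.prems by (simp flip: power_Suc add: Suc_diff_Suc)
  finally show ?case using p_gt_1 by simp
qed

lemma card_gamma: "2 \<le> i \<Longrightarrow> i \<le> m \<Longrightarrow> card (gamma i) = p ^ (m - i)"
  using card_gamma_le card_gamma_ge by (simp add: le_antisym)

lemma card_gamma_Suc: "2 \<le> i \<Longrightarrow> i < m \<Longrightarrow> card (gamma i) = p * card (gamma (Suc i))"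
  by (simp add: card_gamma Suc_diff_Suc flip: power_Suc)

text \<open>Normalizers grow: if \<open>gamma i\<close> is the first term inside \<open>M\<close>,
  then the preceding term is not inside \<open>M\<close> but normalizes it, as its commutators lie
  in \<open>gamma i\<close>. By maximality the normalizer is \<open>G\<close>.\<close>

lemma maximal_subgroup_normal:
  assumes M: "maximal_subgroup M G"
  shows "M \<lhd> G"
proof -
  have sub: "subgroup M G" "M \<noteq> carrier G" using M by (auto simp: maximal_subgroup_def)
  have MG: "M \<subseteq> carrier G" using sub(1) by (rule subgroup.subset)
  define i where "i = (LEAST i. gamma i \<subseteq> M)"
  have "gamma m \<subseteq> M" using gamma_m subgroup.one_closed[OF sub(1)] by simp
  then have i: "gamma i \<subseteq> M" unfolding i_def by (rule LeastI)
  have "i \<noteq> 0" "i \<noteq> 1" using i sub MG by auto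
  then obtain k where k: "i = Suc k" "1 \<le> k" by (cases i) auto
  have "\<not> gamma k \<subseteq> M"
    unfolding i_def using k not_less_Least[of k "\<lambda>i. gamma i \<subseteq> M"] by (auto simp: i_def)
  then obtain x where x: "x \<in> gamma k" "x \<notin> M" by blast
  \<comment> \<open>The normalizer of \<open>M\<close>; conditions for both \<open>g\<close> and
    \<open>inv g\<close> make closure under inverses immediate.\<close>
  define Nz where "Nz = {g \<in> carrier G. \<forall>a\<in>M. g \<otimes> a \<otimes> inv g \<in> M \<and> inv g \<otimes> a \<otimes> g \<in> M}"
  have Nz_mult: "g \<otimes> h \<in> Nz" if g: "g \<in> Nz" and h: "h \<in> Nz" for g h
  proof -
    have gh: "g \<in> carrier G" "h \<in> carrier G" using g h by (auto simp: Nz_def)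
    have "g \<otimes> h \<otimes> a \<otimes> inv (g \<otimes> h) \<in> M \<and> inv (g \<otimes> h) \<otimes> a \<otimes> (g \<otimes> h) \<in> M" if a: "a \<in> M" for a
    proof -
      have "a \<in> carrier G" using a MG by auto
      moreover have "g \<otimes> (h \<otimes> a \<otimes> inv h) \<otimes> inv g \<in> M" "inv h \<otimes> (inv g \<otimes> a \<otimes> g) \<otimes> h \<in> M"
        using g h a by (auto simp: Nz_def)
      ultimately show ?thesis using gh by (simp add: m_assoc inv_mult_group)
    qed
    then show ?thesis using gh by (auto simp: Nz_def)
  qed
  have "subgroup Nz G"
  proof (rule subgroupI)
    have "\<one> \<in> Nz" using MG by (auto simp: Nz_def)
    then show "Nz \<noteq> {}" by blast
  qed (auto simp: Nz_def[symmetric] Nz_mult, auto simp: Nz_def)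
  moreover have "M \<subseteq> Nz"
    using MG subgroup.m_closed[OF sub(1)] subgroup.m_inv_closed[OF sub(1)]
    by (auto simp: Nz_def)
  moreover have "x \<in> Nz"
  proof -
    have xG: "x \<in> carrier G" using x lower_central_subset by blast
    have conj: "inv y \<otimes> a \<otimes> y \<in> M" if "y \<in> gamma k" "a \<in> M" for y a
    proof -
      have yG: "y \<in> carrier G" and aG: "a \<in> carrier G" using that lower_central_subset MG by auto
      have "commutator G y a \<in> gamma i"
        using gamma_central_mod[OF k(2)] that(1) aG k(1) by (auto simp: centralizer_mod_def)
      then have "commutator G a y \<in> M"
        using commutator_mem_sym[OF lower_central_subgroup yG aG] i by blast
      then have "a \<otimes> commutator G a y \<in> M" using subgroup.m_closed[OF sub(1) that(2)] by blast
      then show ?thesis using yG aG by (simp add: commutator_def m_assoc inv_cancel_left)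
    qed
    have "inv x \<in> gamma k" using x subgroup.m_inv_closed[OF lower_central_subgroup] by blast
    then show ?thesis using conj[OF x(1)] conj[of "inv x"] xG by (auto simp: Nz_def)
  qed
  ultimately have "Nz = carrier G"
    using M x(2) unfolding maximal_subgroup_def by blast
  then show ?thesis
    using sub(1) by (intro normal_invI) (auto simp: Nz_def)
qed

text \<open>The center of the quotient by \<open>M\<close> is nontrivial, so by maximality its
  preimage is \<open>G\<close>; the quotient is therefore abelian.\<close>

lemma gamma_2_subset_maximal:
  assumes M: "maximal_subgroup M G"
  shows "gamma 2 \<subseteq> M"
proof -
  have sub: "subgroup M G" "M \<noteq> carrier G" using M by (auto simp: maximal_subgroup_def)
  have "M \<lhd> G" using M by (rule maximal_subgroup_normal)
  then have "M \<subset> centralizer_mod G M (carrier G)" "subgroup (centralizer_mod G M (carrier G)) G"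
    using centralizer_mod_psubset sub by (auto simp: centralizer_mod_subgroup)
  then have "centralizer_mod G M (carrier G) = carrier G"
    using M unfolding maximal_subgroup_def by blast
  then show ?thesis using gamma_2_subset_iff[OF sub(1)] by simp
qed

text \<open>\<open>M\<close> lies strictly between \<open>gamma 2\<close>, of index
  \<open>p ^ 2\<close>, and \<open>G\<close>.\<close>

lemma card_maximal_subgroup:
  assumes M: "maximal_subgroup M G"
  shows "card M = p ^ (m - 1)"
proof -
  have sub: "subgroup M G" "M \<noteq> carrier G" using M by (auto simp: maximal_subgroup_def)
  have MG: "M \<subset> carrier G" using sub subgroup.subset by blast
  have "gamma 2 \<noteq> M" using M gamma_2_not_maximal by auto
  then have "gamma 2 \<subset> M" using gamma_2_subset_maximal[OF M] by blast
  then have "p * card (gamma 2) \<le> card M"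
    using sub lower_central_subgroup by (intro subgroup_psubset_card) auto
  moreover have "p * p ^ (m - 2) = p ^ (m - 1)" "p * p ^ (m - 1) = p ^ m"
    using m_ge_4 by (simp_all add: Suc_diff_Suc numeral_2_eq_2 flip: power_Suc)
  moreover have "p * card M \<le> card (carrier G)"
    using sub MG subgroup_self by (intro subgroup_psubset_card) auto
  ultimately have "p ^ (m - 1) \<le> card M" "p * card M \<le> p * p ^ (m - 1)"
    using card_gamma[of 2] m_ge_4 order by (simp_all add: order_def)
  then show ?thesis using p_gt_1 by simp
qed

end

section \<open>Centralizers of elements outside a maximal subgroup, and maximality of
  \<open>P1\<close>\<close>

context maximal_class_group
begin

lemma card_maximal:
  assumes "maximal_subgroup M G"
  shows "card M = p * card (gamma 2)"
proof -
  have "Suc (m - 2) = m - 1" using m_ge_4 by simp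
  then have "p ^ (m - 1) = p * p ^ (m - 2)" by (metis power_Suc)
  then show ?thesis using card_maximal_subgroup[OF assms] card_gamma[of 2] m_ge_4 by simp
qed

text \<open>If \<open>y\<close> lies in \<open>gamma i\<close> but not in
  \<open>gamma (Suc i)\<close>, then \<open>M\<close> and \<open>x\<close>, hence all of
  \<open>G\<close>, centralize \<open>y\<close> modulo \<open>gamma (Suc (Suc i))\<close>. Since
  \<open>y\<close> and \<open>gamma (Suc i)\<close> generate \<open>gamma i\<close>, the latter
  would be central modulo \<open>gamma (Suc (Suc i))\<close>, which is impossible. So
  \<open>y\<close> descends to the last nontrivial term.\<close>

lemma commuting_with_outer:
  assumes M: "maximal_subgroup M G"
    and central: "\<And>i. 2 \<le> i \<Longrightarrow> i < m \<Longrightarrow> M \<subseteq> centralizer_mod G (gamma (Suc (Suc i))) (gamma i)"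
    and x: "x \<in> carrier G" "x \<notin> M" and y: "y \<in> M" and xy: "x \<otimes> y = y \<otimes> x"
  shows "y \<in> gamma (m - 1)"
proof -
  have sub: "subgroup M G" using M by (auto simp: maximal_subgroup_def)
  have yG: "y \<in> carrier G" "{y} \<subseteq> carrier G" using sub y by (auto dest: subgroup.mem_carrier)
  \<comment> \<open>The centralizer of \<open>y\<close> modulo \<open>gamma i\<close> contains
    \<open>M\<close> and also \<open>x\<close>, which lies outside the maximal subgroup
    \<open>M\<close>.\<close>
  have whole: "y \<in> centralizer_mod G (gamma i) (carrier G)"
    if "M \<subseteq> centralizer_mod G (gamma i) {y}" for i
  proof -
    have "commutator G x y \<in> gamma i"
      using xy x yG subgroup.one_closed[OF lower_central_subgroup] by (simp add: iffD2[OF commutator_one_iff])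
    then have "x \<in> centralizer_mod G (gamma i) {y}" using x by (simp add: centralizer_mod_def)
    then have "centralizer_mod G (gamma i) {y} = carrier G"
      using M that x(2) centralizer_mod_subgroup[OF lower_central_normal yG(2)]
      unfolding maximal_subgroup_def by blast
    then show ?thesis
      using centralizer_mod_swap[OF lower_central_subgroup yG(2) subset_refl] by simp
  qed
  have "y \<in> gamma i" if "2 \<le> i" "i \<le> m - 1" for i
    using that
  proof (induction i rule: dec_induct)
    case base
    show ?case
    proof (rule ccontr)
      assume ny: "y \<notin> gamma 2"
      have gM: "gamma 2 \<subseteq> M" using M by (rule gamma_2_subset_maximal)
      \<comment> \<open>\<open>gamma 2\<close> has index \<open>p\<close> in \<open>M\<close>, so
        together with \<open>y\<close> it generates \<open>M\<close>. Here \<open>M\<close> plays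
        the role that \<open>gamma i\<close> has in the later steps.\<close>
      have fill: "M \<subseteq> L" if "subgroup L G" "gamma 2 \<subseteq> L" "y \<in> L" for L
      proof -
        have "subgroup (L \<inter> M) G" using that(1) sub by (rule subgroups_Inter_pair)
        then show ?thesis
          using subgroup_between[OF lower_central_subgroup sub, of "L \<inter> M" 2] that gM card_maximal[OF M] ny y
          by blast
      qed
      have g3: "gamma 2 \<subseteq> centralizer_mod G (gamma 3) (carrier G)"
        using gamma_central_mod[of 2] by (simp add: numeral_3_eq_3 numeral_2_eq_2)
      have "M \<subseteq> centralizer_mod G (gamma 3) {y}"
      proof (rule fill)
        show "subgroup (centralizer_mod G (gamma 3) {y}) G"
          by (rule centralizer_mod_subgroup[OF lower_central_normal yG(2)])
        show "gamma 2 \<subseteq> centralizer_mod G (gamma 3) {y}"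
          using g3 yG(1) by (auto simp: centralizer_mod_def)
        show "y \<in> centralizer_mod G (gamma 3) {y}"
          using lower_central_normal yG(1) by (rule centralizer_mod_self)
      qed
      then have "y \<in> centralizer_mod G (gamma 3) (carrier G)" by (rule whole)
      then have "M \<subseteq> centralizer_mod G (gamma 3) (carrier G)"
        using g3 by (intro fill centralizer_mod_subgroup[OF lower_central_normal]) auto
      then show False using maximal_not_central_mod[OF M] by simp
    qed
  next
    case (step i)
    show ?case
    proof (rule ccontr)
      assume ny: "y \<notin> gamma (Suc i)"
      let ?Z = "centralizer_mod G (gamma (Suc (Suc i))) (carrier G)"
      have yi: "y \<in> gamma i" and i: "i < m" "Suc i < m" using step by auto
      have "M \<subseteq> centralizer_mod G (gamma (Suc (Suc i))) {y}"
        using central[OF step.hyps(1) i(1)] yi by (auto simp: centralizer_mod_def)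
      then have "y \<in> ?Z" by (rule whole)
      moreover have Z: "subgroup (?Z \<inter> gamma i) G"
        by (intro subgroups_Inter_pair centralizer_mod_subgroup lower_central_normal lower_central_subgroup) auto
      moreover have "gamma (Suc i) \<subseteq> ?Z \<inter> gamma i"
        using gamma_central_mod[of "Suc i"] lower_central_Suc_subset[of i] by simp
      ultimately have "?Z \<inter> gamma i = gamma i"
        using subgroup_between[OF lower_central_subgroup lower_central_subgroup Z, of "Suc i" i]
          card_gamma_Suc[OF step.hyps(1) i(1)] yi ny by blast
      then show False using gamma_not_central_mod[of i] i step.hyps(1) by auto
    qed
  qed
  then show ?thesis using m_ge_4 by simp
qed

lemma gamma_last_central: "x \<in> gamma (m - 1) \<Longrightarrow> y \<in> carrier G \<Longrightarrow> x \<otimes> y = y \<otimes> x"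
proof -
  assume x: "x \<in> gamma (m - 1)" and y: "y \<in> carrier G"
  have "1 \<le> m - 1" using m_ge_4 by simp
  then have "commutator G x y \<in> gamma (Suc (m - 1))"
    using gamma_central_mod[of "m - 1"] x y by (auto simp: centralizer_mod_def)
  then have "commutator G x y = \<one>" using m_ge_4 gamma_m by simp
  then show ?thesis
    using x y lower_central_subset by (subst (asm) commutator_one_iff) auto
qed

abbreviation cent :: "'a \<Rightarrow> 'a set" where
  "cent x \<equiv> centralizer_mod G {\<one>} {x}"

lemma cent_eq: "x \<in> carrier G \<Longrightarrow> cent x = {y \<in> carrier G. x \<otimes> y = y \<otimes> x}"
  by (auto simp: centralizer_mod_def commutator_one_iff)

lemma cent_subgroup: "x \<in> carrier G \<Longrightarrow> subgroup (cent x) G"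
  by (intro centralizer_mod_subgroup one_is_normal) auto

text \<open>A group with a central subgroup of index \<open>p\<close> is abelian.\<close>

lemma abelian_extend:
  assumes "subgroup H G" "subgroup K G" "H \<subseteq> K" "card K = p * card H"
    and "\<And>h k. h \<in> H \<Longrightarrow> k \<in> K \<Longrightarrow> h \<otimes> k = k \<otimes> h"
  shows "abelian_set G K"
proof -
  have KG: "K \<subseteq> carrier G" using assms(2) by (rule subgroup.subset)
  have "H \<subseteq> centralizer_mod G {\<one>} K"
    using assms(3,5) KG by (auto simp: centralizer_mod_def commutator_one_iff subset_iff)
  then have "K \<subseteq> centralizer_mod G {\<one>} K"
    using assms one_is_normal by (intro centralizer_mod_extend_card) auto
  then have "commutator G x y = \<one>" if "x \<in> K" "y \<in> K" for x y
    using that by (auto simp: centralizer_mod_def)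
  then show ?thesis
    unfolding abelian_set_def using KG commutator_one_iff by blast
qed

text \<open>Since \<open>M\<close> has index \<open>p\<close> and meets \<open>cent x\<close> in a
  subgroup of order \<open>p\<close>, the product bound gives order at most \<open>p ^ 2\<close>.
  The element \<open>x\<close> itself makes \<open>cent x\<close> strictly larger than the
  intersection. As \<open>gamma (m - 1)\<close> is central of index \<open>p\<close> in
  \<open>cent x\<close>, the latter is abelian.\<close>

lemma outer_centralizer:
  assumes M: "maximal_subgroup M G"
    and central: "\<And>i. 2 \<le> i \<Longrightarrow> i < m \<Longrightarrow> M \<subseteq> centralizer_mod G (gamma (Suc (Suc i))) (gamma i)"
    and x: "x \<in> carrier G" "x \<notin> M"
  shows "cent x \<inter> M = gamma (m - 1)" "card (cent x) = p ^ 2" "abelian_set G (cent x)"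
proof -
  have sub: "subgroup M G" using M by (auto simp: maximal_subgroup_def)
  have "2 \<le> m - 1" using m_ge_4 by simp
  then have gM: "gamma (m - 1) \<subseteq> M"
    using gamma_2_subset_maximal[OF M] lower_central_antimono[of 2 "m - 1"] by auto
  show int: "cent x \<inter> M = gamma (m - 1)"
  proof (intro equalityI subsetI)
    fix y assume y: "y \<in> gamma (m - 1)"
    then have "y \<in> carrier G" using lower_central_subset by blast
    then show "y \<in> cent x \<inter> M"
      using gamma_last_central[OF y x(1)] y gM x(1) by (auto simp: cent_eq)
  qed (use commuting_with_outer[OF M central x] x(1) in \<open>auto simp: cent_eq\<close>)
  have card_Z: "card (gamma (m - 1)) = p" using m_ge_4 by (simp add: card_gamma)
  have "card (cent x) * card M \<le> p ^ m * p"
    using card_mult_le[OF cent_subgroup[OF x(1)] sub finite_carrier] int card_Z order by simp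
  also have "p ^ m = p * card M"
    using m_ge_4 by (simp add: card_maximal_subgroup[OF M] Suc_diff_Suc flip: power_Suc)
  finally have "card (cent x) * card M \<le> (p * p) * card M" by (simp add: ac_simps)
  moreover have "card M > 0" using p_gt_1 by (simp add: card_maximal_subgroup[OF M])
  ultimately have le: "card (cent x) \<le> p * p" by simp
  have "gamma (m - 1) \<subset> cent x"
    using int x gM centralizer_mod_self[OF one_is_normal x(1)] by blast
  then have "p * p \<le> card (cent x)"
    using subgroup_psubset_card[OF lower_central_subgroup cent_subgroup[OF x(1)]] card_Z by metis
  with le have eq: "card (cent x) = p * card (gamma (m - 1))" using card_Z by simp
  then show "card (cent x) = p ^ 2" using card_Z by (simp add: power2_eq_square)
  show "abelian_set G (cent x)"
  proof (rule abelian_extend[OF lower_central_subgroup cent_subgroup[OF x(1)] _ eq])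
    show "gamma (m - 1) \<subseteq> cent x" using int by blast
  qed (use gamma_last_central in \<open>auto simp: centralizer_mod_def\<close>)
qed

definition P1 :: "'a set" where
  "P1 = centralizer_mod G (gamma 4) (gamma 2)"

text \<open>Take \<open>s\<close> in \<open>gamma 2\<close> outside \<open>gamma 3\<close>. As
  \<open>gamma 3\<close> is central modulo \<open>gamma 4\<close>, whatever centralizes
  \<open>s\<close> modulo \<open>gamma 4\<close> centralizes all of \<open>gamma 2\<close>. The
  commutators of \<open>s\<close> fall into the \<open>p\<close> cosets of \<open>gamma 4\<close> in
  \<open>gamma 3\<close>, so the index is at most \<open>p\<close>; it is not 1 because
  \<open>gamma 2\<close> is not central modulo \<open>gamma 4\<close>.\<close>

lemma P1_maximal: "maximal_subgroup P1 G"
proof -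
  have sub: "subgroup P1 G"
    unfolding P1_def by (intro centralizer_mod_subgroup lower_central_normal lower_central_subset)
  have g: "gamma 3 \<subset> gamma 2"
    using gamma_psubset[of 2] m_ge_4 by (simp add: numeral_3_eq_3 numeral_2_eq_2)
  have g34: "gamma 3 \<subseteq> centralizer_mod G (gamma 4) (carrier G)"
    using gamma_central_mod[of 3] by (simp add: eval_nat_numeral)
  obtain s where s: "s \<in> gamma 2" "s \<notin> gamma 3" using g by blast
  have sG: "s \<in> carrier G" using s lower_central_subset by blast
  have "centralizer_mod G (gamma 4) {s} \<subseteq> P1"
  proof
    fix h assume h: "h \<in> centralizer_mod G (gamma 4) {s}"
    then have hG: "h \<in> carrier G" "{h} \<subseteq> carrier G" by (auto simp: centralizer_mod_def)
    let ?C = "centralizer_mod G (gamma 4) {h}"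
    have "s \<in> ?C"
      using h centralizer_mod_swap[OF lower_central_subgroup, of "{s}" "{h}" 4] sG hG by simp
    moreover have "gamma 3 \<subseteq> ?C"
      using g34 hG by (auto simp: centralizer_mod_def)
    moreover have C: "subgroup (?C \<inter> gamma 2) G"
      using hG(2) by (intro subgroups_Inter_pair centralizer_mod_subgroup lower_central_normal lower_central_subgroup)
    moreover have "card (gamma 2) = p * card (gamma 3)"
      using card_gamma_Suc[of 2] m_ge_4 by (simp add: numeral_3_eq_3 numeral_2_eq_2)
    ultimately have "gamma 2 \<subseteq> ?C"
      using subgroup_between[OF lower_central_subgroup lower_central_subgroup C, of 3 2] s g by blast
    then show "h \<in> P1"
      unfolding P1_def using centralizer_mod_swap[OF lower_central_subgroup lower_central_subset hG(2)] by blast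
  qed
  then have le: "card (centralizer_mod G (gamma 4) {s}) \<le> card P1"
    using finite_subgroup[OF sub] by (rule card_mono[rotated])
  have "commutator G s g \<in> gamma 3" if "g \<in> carrier G" for g
    using gamma_central_mod[of 2] s that by (auto simp: centralizer_mod_def numeral_3_eq_3 numeral_2_eq_2)
  moreover have "gamma 4 \<subseteq> gamma 3" by (intro lower_central_antimono) simp
  ultimately have "order G * card (gamma 4) \<le> card (gamma 3) * card (centralizer_mod G (gamma 4) {s})"
    using sG finite_carrier
    by (intro card_commutator_fibers lower_central_normal lower_central_subgroup) auto
  also have "card (gamma 3) = p * card (gamma 4)"
    using card_gamma_Suc[of 3] m_ge_4 by (simp add: eval_nat_numeral)
  finally have "card (gamma 4) * order G \<le> card (gamma 4) * (p * card (centralizer_mod G (gamma 4) {s}))"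
    by (simp add: ac_simps)
  moreover have "card (gamma 4) > 0" using p_gt_1 m_ge_4 by (simp add: card_gamma)
  ultimately have "order G \<le> p * card (centralizer_mod G (gamma 4) {s})" by simp
  then have "order G \<le> p * card P1" using le by (meson le_trans mult_le_mono2)
  moreover have "P1 \<noteq> carrier G"
  proof
    assume "P1 = carrier G"
    then have "gamma 2 \<subseteq> centralizer_mod G (gamma 4) (carrier G)"
      using centralizer_mod_swap[OF lower_central_subgroup lower_central_subset subset_refl] by (auto simp: P1_def)
    then show False using gamma_not_central_mod[of 2] m_ge_4 by (simp add: eval_nat_numeral)
  qed
  then have "P1 \<subset> carrier G" using subgroup.subset[OF sub] by blast
  then have "p * card P1 \<le> order G"
    unfolding order_def using sub subgroup_self by (intro subgroup_psubset_card)
  ultimately show ?thesis using sub by (intro maximal_subgroupI_card) auto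
qed

end

section \<open>Counting commuting tuples\<close>

definition commuting_in :: "('a, 'b) monoid_scheme \<Rightarrow> 'a set \<Rightarrow> nat \<Rightarrow> 'a list set" where
  "commuting_in G S n = {xs. length xs = n \<and> set xs \<subseteq> S \<and> abelian_set G (set xs)}"

lemma abelian_set_subset: "abelian_set G A \<Longrightarrow> B \<subseteq> A \<Longrightarrow> abelian_set G B"
  by (auto simp: abelian_set_def)

lemma commuting_in_carrier: "commuting_in G (carrier G) n = commuting_tuples G n"
  by (simp add: commuting_in_def commuting_tuples_def abelian_set_def)

lemma finite_commuting_in: "finite S \<Longrightarrow> finite (commuting_in G S n)"
  by (rule finite_subset[OF _ finite_lists_length_eq[of S n]]) (auto simp: commuting_in_def)

lemma card_commuting_in_abelian:
  "finite S \<Longrightarrow> abelian_set G S \<Longrightarrow> card (commuting_in G S n) = card S ^ n"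
  by (subst card_lists_length_eq[symmetric], assumption, rule arg_cong[of _ _ card])
     (auto simp: commuting_in_def abelian_set_def)

text \<open>Splits on the first entry: if it lies outside \<open>T\<close>, the remaining entries range over its
  abelian centralizer; if it lies in \<open>T\<close>, it commutes with a later entry outside \<open>T\<close> and
  hence lies in \<open>Z\<close>.\<close>

lemma card_commuting_in_diff_Suc:
  fixes G :: "('a, 'b) monoid_scheme"
  assumes fin: "finite S" and "T \<subseteq> S" and Z: "S - T \<noteq> {} \<Longrightarrow> card Z = z"
    and C: "\<And>x. x \<in> S - T \<Longrightarrow> C x = {y \<in> S. x \<otimes>\<^bsub>G\<^esub> y = y \<otimes>\<^bsub>G\<^esub> x}"
    and abel: "\<And>x. x \<in> S - T \<Longrightarrow> abelian_set G (C x)"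
    and c: "\<And>x. x \<in> S - T \<Longrightarrow> card (C x) = c"
    and int: "\<And>x. x \<in> S - T \<Longrightarrow> C x \<inter> T = Z"
  defines "D \<equiv> \<lambda>n. {xs \<in> commuting_in G S n. \<not> set xs \<subseteq> T}"
  shows "card (D (Suc n)) = card (S - T) * c ^ n + z * card (D n)"
proof -
  let ?A = "SIGMA x:S - T. {xs. set xs \<subseteq> C x \<and> length xs = n}"
  let ?B = "Z \<times> D n"
  let ?cons = "\<lambda>(x, xs). x # xs"
  have finC: "finite (C x)" if "x \<in> S - T" for x using fin C[OF that] by simp
  have finD: "finite (D n)" 
    unfolding D_def using finite_commuting_in[OF fin, of G n] by (rule rev_finite_subset) blast
  have "D (Suc n) = ?cons ` ?A \<union> ?cons ` ?B"
  proof (intro equalityI subsetI)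
    fix ys assume ys: "ys \<in> D (Suc n)"
    then obtain x xs where x: "ys = x # xs" "length xs = n"
      by (cases ys) (auto simp: D_def commuting_in_def)
    have sub: "x \<in> S" "set xs \<subseteq> S" and comm: "abelian_set G (insert x (set xs))"
      and out: "x \<notin> T \<or> \<not> set xs \<subseteq> T"
      using ys x by (auto simp: D_def commuting_in_def)
    show "ys \<in> ?cons ` ?A \<union> ?cons ` ?B"
    proof (cases "x \<in> T")
      case False
      then have "(x, xs) \<in> ?A" using sub comm x C[of x] by (auto simp: abelian_set_def)
      then show ?thesis unfolding x(1) by (intro UnI1 image_eqI[of _ _ "(x, xs)"]) auto
    next
      case True
      with out obtain y where y: "y \<in> set xs" "y \<notin> T" by blast
      then have "y \<in> S - T" using sub by blast
      then have "x \<in> Z" using int[of y] C[of y] True sub comm y by (auto simp: abelian_set_def)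
      moreover have "xs \<in> D n"
        using sub comm y x by (auto simp: D_def commuting_in_def abelian_set_def)
      ultimately show ?thesis unfolding x(1) by (intro UnI2 image_eqI[of _ _ "(x, xs)"]) auto
    qed
  next
    fix ys assume "ys \<in> ?cons ` ?A \<union> ?cons ` ?B"
    then show "ys \<in> D (Suc n)"
    proof
      assume "ys \<in> ?cons ` ?A"
      then obtain x xs where x: "ys = x # xs" "x \<in> S - T" "set xs \<subseteq> C x" "length xs = n" by auto
      have "x \<in> C x" using C[OF x(2)] x(2) by simp
      then have "set ys \<subseteq> C x" using x by simp
      then have "abelian_set G (set ys)" "set ys \<subseteq> S"
        using abelian_set_subset[OF abel[OF x(2)]] C[OF x(2)] by auto
      then show ?thesis using x by (auto simp: D_def commuting_in_def)
    next
      assume "ys \<in> ?cons ` ?B"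
      then obtain x xs where x: "ys = x # xs" "x \<in> Z" "xs \<in> D n" by auto
      then obtain y where y: "y \<in> set xs" "y \<in> S - T" by (auto simp: D_def commuting_in_def)
      have "set xs \<subseteq> S" "abelian_set G (set xs)"
        using x(3) by (auto simp: D_def commuting_in_def)
      then have "set xs \<subseteq> C y" using y(1) C[OF y(2)] by (auto simp: abelian_set_def)
      then have "set ys \<subseteq> C y" using x int[OF y(2)] by auto
      then have "set ys \<subseteq> S" "abelian_set G (set ys)"
        using abelian_set_subset[OF abel[OF y(2)]] C[OF y(2)] by auto
      then show ?thesis using x y by (auto simp: D_def commuting_in_def)
    qed
  qed
  moreover have "?cons ` ?A \<inter> ?cons ` ?B = {}"
    using int by (auto simp: D_def)
  moreover have "finite ?A" using fin finC by (intro finite_SigmaI finite_lists_length_eq) auto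
  moreover have D_empty: "D n = {}" if "S - T = {}"
    using that assms(2) by (auto simp: D_def commuting_in_def)
  moreover have "finite ?B"
  \<comment> \<open>\<open>Z\<close> is known to lie in some finite \<open>C x\<close> only if there
    is an \<open>x\<close> in \<open>S - T\<close>; otherwise the product is empty because
    \<open>D n\<close> is.\<close>
  proof (cases "S - T = {}")
    case True
    then show ?thesis using D_empty by simp
  next
    case False
    then have "finite Z" using finC int by blast
    then show ?thesis using finD by simp
  qed
  ultimately have "card (D (Suc n)) = card (?cons ` ?A) + card (?cons ` ?B)"
    by (simp add: card_Un_disjoint)
  moreover have "card (?cons ` X) = card X" for X :: "('a \<times> 'a list) set"
    by (rule card_image) (auto simp: inj_on_def)
  ultimately have "card (D (Suc n)) = card ?A + card ?B" by simp
  moreover have "card ?A = (\<Sum>x\<in>S - T. c ^ n)"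
    using fin finC by (subst card_SigmaI) (auto simp: c finite_lists_length_eq card_lists_length_eq)
  moreover have "card ?B = z * card (D n)"
    using Z D_empty by (cases "S - T = {}") (auto simp: card_cartesian_product)
  ultimately show ?thesis by simp
qed

lemma card_commuting_in_diff:
  fixes G :: "('a, 'b) monoid_scheme"
  assumes fin: "finite S" and "T \<subseteq> S" and Z: "S - T \<noteq> {} \<Longrightarrow> card Z = z"
    and C: "\<And>x. x \<in> S - T \<Longrightarrow> C x = {y \<in> S. x \<otimes>\<^bsub>G\<^esub> y = y \<otimes>\<^bsub>G\<^esub> x}"
    and abel: "\<And>x. x \<in> S - T \<Longrightarrow> abelian_set G (C x)"
    and c: "\<And>x. x \<in> S - T \<Longrightarrow> card (C x) = c"
    and int: "\<And>x. x \<in> S - T \<Longrightarrow> C x \<inter> T = Z"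
  shows "(of_nat c - of_nat z) * (of_nat (card (commuting_in G S n)) - of_nat (card (commuting_in G T n)))
    = (of_nat (card S) - of_nat (card T)) * ((of_nat c ^ n - of_nat z ^ n) :: 'r :: comm_ring_1)"
proof -
  let ?D = "\<lambda>n. {xs \<in> commuting_in G S n. \<not> set xs \<subseteq> T}"
  have ST: "(of_nat (card (S - T)) :: 'r) = of_nat (card S) - of_nat (card T)"
    using assms(2) fin by (simp add: card_Diff_subset finite_subset card_mono of_nat_diff)
  have "(of_nat c - of_nat z) * of_nat (card (?D n)) =
    of_nat (card (S - T)) * ((of_nat c ^ n - of_nat z ^ n) :: 'r)"
  proof (induction n)
    case 0
    have "?D 0 = {}" by (auto simp: commuting_in_def)
    then show ?case by (simp only: card.empty) simp
  next
    case (Suc n)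
    let ?a = "of_nat (card (S - T)) :: 'r" and ?c = "of_nat c :: 'r" and ?z = "of_nat z :: 'r"
    have "of_nat (card (?D (Suc n))) = ?a * ?c ^ n + ?z * of_nat (card (?D n))"
      using card_commuting_in_diff_Suc[OF assms] by simp
    then have "(?c - ?z) * of_nat (card (?D (Suc n))) =
        (?c - ?z) * (?a * ?c ^ n) + ?z * ((?c - ?z) * of_nat (card (?D n)))"
      by (simp add: algebra_simps)
    then show ?case unfolding Suc by (simp add: algebra_simps)
  qed
  moreover have "card (commuting_in G S n) = card (commuting_in G T n) + card (?D n)"
  proof -
    have "commuting_in G S n = commuting_in G T n \<union> ?D n"
      using assms(2) by (auto simp: commuting_in_def)
    then have "card (commuting_in G S n) = card (commuting_in G T n \<union> ?D n)"
      by (rule arg_cong)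
    moreover have "commuting_in G T n \<inter> ?D n = {}" by (auto simp: commuting_in_def)
    ultimately show ?thesis
      using finite_commuting_in[OF fin, of G n]
        finite_commuting_in[OF finite_subset[OF assms(2) fin], of G n]
      by (simp add: card_Un_disjoint)
  qed
  ultimately show ?thesis using ST by simp
qed

section \<open>Simultaneous conjugation as a group action, and its orbits\<close>

lemma (in group) conj_tuple_mult:
  assumes "g \<in> carrier G" "h \<in> carrier G" "set xs \<subseteq> carrier G"
  shows "conj_tuple G (g \<otimes> h) xs = conj_tuple G g (conj_tuple G h xs)"
  using assms by (auto simp: conj_tuple_def inv_mult_group m_assoc subset_iff)

lemma (in group) conj_tuple_one:
  "set xs \<subseteq> carrier G \<Longrightarrow> conj_tuple G \<one> xs = xs"
  by (auto simp: conj_tuple_def subset_iff intro: map_idI)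

lemma (in group) conj_tuple_commuting:
  assumes "g \<in> carrier G" "xs \<in> commuting_tuples G n"
  shows "conj_tuple G g xs \<in> commuting_tuples G n"
proof -
  have "(g \<otimes> x \<otimes> inv g) \<otimes> (g \<otimes> y \<otimes> inv g) = (g \<otimes> y \<otimes> inv g) \<otimes> (g \<otimes> x \<otimes> inv g)"
    if "x \<in> set xs" "y \<in> set xs" for x y
  proof -
    have xy: "x \<in> carrier G" "y \<in> carrier G" "x \<otimes> y = y \<otimes> x"
      using assms(2) that by (auto simp: commuting_tuples_def)
    then have "x \<otimes> (y \<otimes> inv g) = y \<otimes> (x \<otimes> inv g)"
      using assms(1) by (simp flip: m_assoc)
    then show ?thesis using assms(1) xy(1,2) by (simp add: m_assoc inv_cancel_left)
  qed
  then show ?thesis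
    using assms by (auto simp: commuting_tuples_def conj_tuple_def)
qed

text \<open>The maps are restricted because \<open>Bij\<close> consists of extensional functions;
  the inverse map is conjugation by \<open>inv g\<close>.\<close>

lemma (in group) conj_tuple_action:
  "group_action G (commuting_tuples G n) (\<lambda>g. restrict (conj_tuple G g) (commuting_tuples G n))"
proof -
  let ?E = "commuting_tuples G n" and ?phi = "\<lambda>g. restrict (conj_tuple G g) (commuting_tuples G n)"
  have sub: "set xs \<subseteq> carrier G" if "xs \<in> ?E" for xs
    using that by (simp add: commuting_tuples_def)
  have inv: "conj_tuple G g (conj_tuple G (inv g) xs) = xs" "conj_tuple G (inv g) (conj_tuple G g xs) = xs"
    if "g \<in> carrier G" "xs \<in> ?E" for g xs
    using that sub[OF that(2)] by (simp_all flip: conj_tuple_mult add: conj_tuple_one)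
  have bij: "?phi g \<in> Bij ?E" if g: "g \<in> carrier G" for g
  proof -
    have "bij_betw (?phi g) ?E ?E"
      using g inv conj_tuple_commuting by (intro bij_betwI[of _ _ _ "conj_tuple G (inv g)"]) auto
    then show ?thesis by (simp add: Bij_def)
  qed
  have "?phi (g \<otimes> h) = ?phi g \<otimes>\<^bsub>BijGroup ?E\<^esub> ?phi h"
    if "g \<in> carrier G" "h \<in> carrier G" for g h
    using that bij conj_tuple_commuting sub
    by (auto simp: BijGroup_def compose_def conj_tuple_mult fun_eq_iff restrict_def)
  then have "?phi \<in> hom G (BijGroup ?E)"
    using bij by (auto simp: hom_def BijGroup_def)
  then show ?thesis
    by (simp add: group_action_def group_hom_def group_hom_axioms_def group_BijGroup is_group)
qed

text \<open>Burnside's lemma, where a tuple fixed by \<open>g\<close> is the same as a commuting tuple with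
  \<open>g\<close> prepended.\<close>

lemma (in group) beta_times_order:
  assumes fin: "finite (carrier G)"
  shows "beta G n * order G = card (commuting_tuples G (Suc n))"
proof -
  let ?E = "commuting_tuples G n" and ?phi = "\<lambda>g. restrict (conj_tuple G g) (commuting_tuples G n)"
  interpret group_action G ?E ?phi by (rule conj_tuple_action)
  have finE: "finite ?E" using finite_commuting_in[OF fin, of G n] by (simp add: commuting_in_carrier)
  have "orbits G ?E ?phi = (\<lambda>xs. (\<lambda>g. conj_tuple G g xs) ` carrier G) ` ?E"
    by (auto simp: orbits_def orbit_def image_def)
  then have "beta G n * order G = (\<Sum>g\<in>carrier G. card (invariants ?E ?phi g))"
    using burnside[OF fin finE] by (simp add: beta_def)
  also have "\<dots> = card (SIGMA g:carrier G. invariants ?E ?phi g)"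
    using fin finE by (subst card_SigmaI) (auto simp: invariants_def)
  also have "\<dots> = card ((\<lambda>(g, xs). g # xs) ` (SIGMA g:carrier G. invariants ?E ?phi g))"
    by (rule card_image[symmetric]) (auto simp: inj_on_def)
  also have "(\<lambda>(g, xs). g # xs) ` (SIGMA g:carrier G. invariants ?E ?phi g) = commuting_tuples G (Suc n)"
  proof -
    have inv_iff: "conj_tuple G g xs = xs \<longleftrightarrow> (\<forall>x\<in>set xs. g \<otimes> x = x \<otimes> g)"
      if "g \<in> carrier G" "set xs \<subseteq> carrier G" for g xs
    proof -
      have "g \<otimes> x \<otimes> inv g = x \<longleftrightarrow> g \<otimes> x = x \<otimes> g" if "x \<in> set xs" for x
        using \<open>g \<in> carrier G\<close> \<open>set xs \<subseteq> carrier G\<close> that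
        by (metis inv_solve_right m_closed subsetD)
      then show ?thesis by (simp add: conj_tuple_def map_idI list_eq_iff_nth_eq all_set_conv_all_nth)
    qed
    have "g # xs \<in> commuting_tuples G (Suc n) \<longleftrightarrow> g \<in> carrier G \<and> xs \<in> invariants ?E ?phi g" for g xs
      using inv_iff[of g xs] by (auto simp: commuting_tuples_def invariants_def)
    moreover have "ys \<noteq> []" if "ys \<in> commuting_tuples G (Suc n)" for ys
      using that by (auto simp: commuting_tuples_def)
    ultimately show ?thesis
      by (auto simp: image_iff) (metis neq_Nil_conv)
  qed
  finally show ?thesis .
qed

section \<open>Closed formulas for the orbit numbers\<close>

context maximal_class_group
begin

lemma m_pred:
  obtains k where "m = Suc (Suc k)"
  using m_ge_4 that[of "m - 2"] by simp

lemma p_ne: "(of_nat p :: rat) \<noteq> 0" "(of_nat p :: rat) \<noteq> 1"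
  using p_gt_1 by simp_all

text \<open>The counting lemma with centralizers of order \<open>p ^ 2\<close> that meet
  \<open>M\<close> in order \<open>p\<close>; the coefficient is
  \<open>(p ^ m - p ^ (m - 1)) / (p ^ 2 - p) = p ^ (m - 2)\<close>.\<close>

lemma card_commuting_tuples:
  assumes M: "maximal_subgroup M G"
    and central: "\<And>i. 2 \<le> i \<Longrightarrow> i < m \<Longrightarrow> M \<subseteq> centralizer_mod G (gamma (Suc (Suc i))) (gamma i)"
  shows "(of_nat (card (commuting_tuples G n)) :: rat) = of_nat (card (commuting_in G M n))
    + of_nat p ^ (m - 2) * ((of_nat p ^ 2) ^ n - of_nat p ^ n)"
proof -
  let ?P = "of_nat p :: rat"
  obtain k where k: "m = Suc (Suc k)" by (rule m_pred)
  have MG: "M \<subseteq> carrier G" using M by (auto simp: maximal_subgroup_def dest: subgroup.subset)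
  have "(of_nat (p ^ 2) - ?P) *
      (of_nat (card (commuting_in G (carrier G) n)) - of_nat (card (commuting_in G M n)))
    = (of_nat (card (carrier G)) - of_nat (card M)) * (of_nat (p ^ 2) ^ n - ?P ^ n)"
  proof (rule card_commuting_in_diff[where C = cent and Z = "gamma (m - 1)"])
    show "card (gamma (m - 1)) = p" using m_ge_4 by (simp add: card_gamma)
  qed (use finite_carrier MG outer_centralizer[OF M central] cent_eq in auto)
  moreover have "of_nat (card (carrier G)) - of_nat (card M) = ?P ^ (m - 2) * (of_nat (p ^ 2) - ?P)"
    using order card_maximal_subgroup[OF M] k by (simp add: order_def algebra_simps power2_eq_square)
  ultimately have "(of_nat (p ^ 2) - ?P) *
      (of_nat (card (commuting_in G (carrier G) n)) - of_nat (card (commuting_in G M n)))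
    = (of_nat (p ^ 2) - ?P) * (?P ^ (m - 2) * (of_nat (p ^ 2) ^ n - ?P ^ n))"
    by (simp add: ac_simps)
  moreover have "of_nat (p ^ 2) - ?P \<noteq> 0" using p_ne by (simp add: power2_eq_square)
  ultimately have "of_nat (card (commuting_in G (carrier G) n)) - of_nat (card (commuting_in G M n))
    = ?P ^ (m - 2) * (of_nat (p ^ 2) ^ n - ?P ^ n)"
    by (simp only: mult_cancel_left) simp
  then show ?thesis by (simp add: commuting_in_carrier algebra_simps)
qed

lemma beta_times_p_power:
  "(of_nat (beta G n) :: rat) * of_nat p ^ m = of_nat (card (commuting_tuples G (Suc n)))"
  using beta_times_order[OF finite_carrier, of n] order by (metis of_nat_mult of_nat_power)

lemma beta_abelian:
  assumes M: "maximal_subgroup M G" and abel: "abelian_set G M"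
  shows "of_nat p * (of_nat (beta G n) :: rat) =
    (of_nat p ^ (m - 1)) ^ n + of_nat p * (of_nat p ^ 2) ^ n - of_nat p ^ n"
proof -
  let ?P = "of_nat p :: rat"
  obtain k where k: "m = Suc (Suc k)" by (rule m_pred)
  have sub: "subgroup M G" using M by (auto simp: maximal_subgroup_def)
  have MG: "M \<subseteq> carrier G" using sub by (rule subgroup.subset)
  have "M \<subseteq> centralizer_mod G (gamma (Suc (Suc i))) (gamma i)" if "2 \<le> i" for i
  proof -
    have "gamma i \<subseteq> M"
      using gamma_2_subset_maximal[OF M] lower_central_antimono[OF that] by blast
    moreover have "\<one> \<in> gamma (Suc (Suc i))" by (rule subgroup.one_closed[OF lower_central_subgroup])
    ultimately show ?thesis
      using abel MG unfolding centralizer_mod_def abelian_set_def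
      by (auto simp: subset_iff iffD2[OF commutator_one_iff] simp del: lower_central.simps)
  qed
  then have "of_nat (beta G n) * ?P ^ m = (?P ^ (m - 1)) ^ Suc n
      + ?P ^ (m - 2) * ((?P ^ 2) ^ Suc n - ?P ^ Suc n)"
    using card_commuting_tuples[OF M, of "Suc n"] card_maximal_subgroup[OF M]
      card_commuting_in_abelian[OF finite_subgroup[OF sub] abel, of "Suc n"]
    by (simp add: beta_times_p_power)
  \<comment> \<open>The common factor \<open>p ^ (m - 1)\<close> is split off, which leaves one
    factor \<open>p\<close> in front of \<open>beta\<close>.\<close>
  then have "?P ^ Suc k * (?P * of_nat (beta G n)) =
      ?P ^ Suc k * ((?P ^ (m - 1)) ^ n + ?P * (?P ^ 2) ^ n - ?P ^ n)"
    using k by (simp add: algebra_simps power2_eq_square)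
  then show ?thesis using p_ne by (simp only: mult_cancel_left) simp
qed

lemma beta_nonabelian:
  assumes nonab: "\<not> abelian_set G P1"
    and comm: "P1 \<subseteq> centralizer_mod G {\<one>} (gamma 3)"
  shows "5 \<le> m"
    and "of_nat p ^ 2 * (of_nat (beta G n) :: rat) =
      (of_nat p + 1) * (of_nat p ^ (m - 2)) ^ n - (of_nat p ^ (m - 3)) ^ n
      + of_nat p ^ 2 * (of_nat p ^ 2) ^ n - of_nat p * of_nat p ^ n"
proof -
  let ?P = "of_nat p :: rat"
  note M = P1_maximal
  have sub: "subgroup P1 G" using M by (auto simp: maximal_subgroup_def)
  have MG: "P1 \<subseteq> carrier G" using sub by (rule subgroup.subset)
  have g2: "gamma 2 \<subseteq> P1" using M by (rule gamma_2_subset_maximal)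
  have "gamma 3 \<subseteq> gamma 2" by (rule lower_central_antimono) simp
  with g2 have g3: "gamma 3 \<subseteq> P1" by blast
  have comm3: "h \<otimes> k = k \<otimes> h" if "h \<in> gamma 3" "k \<in> P1" for h k
    using comm that MG lower_central_subset[of 3]
    by (auto simp: centralizer_mod_def commutator_one_iff subset_iff)
  show m: "5 \<le> m"
  \<comment> \<open>For \<open>m = 4\<close> the group \<open>gamma 4\<close> is trivial, so
    \<open>gamma 2\<close> is central of index \<open>p\<close> in \<open>P1\<close>, which would
    then be abelian.\<close>
  proof (rule ccontr)
    assume "\<not> 5 \<le> m"
    then have "m = 4" using m_ge_4 by simp
    then have "gamma 4 = {\<one>}" using gamma_m by simp
    then have "h \<otimes> k = k \<otimes> h" if "h \<in> gamma 2" "k \<in> P1" for h k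
      using that MG lower_central_subset[of 2]
      by (auto simp: P1_def centralizer_mod_def commutator_one_iff subset_iff)
    then have "abelian_set G P1"
      using abelian_extend[OF lower_central_subgroup sub g2 card_maximal[OF M]] by blast
    then show False using nonab by simp
  qed
  obtain k where k: "m = k + 5" using m by (metis le_add_diff_inverse2)
  have card_P1: "card P1 = p ^ (m - 1)" using M by (rule card_maximal_subgroup)
  have card_3: "card (gamma 3) = p ^ (m - 3)" using card_gamma[of 3] m by simp
  have C: "subgroup (cent x \<inter> P1) G \<and> gamma 3 \<subseteq> cent x \<inter> P1 \<and> card (cent x \<inter> P1) = p ^ (m - 2)
      \<and> abelian_set G (cent x \<inter> P1)"
    if x: "x \<in> P1 - gamma 3" for x
  proof -
    let ?C = "cent x \<inter> P1"
    have xG: "x \<in> carrier G" using x MG by auto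
    have C: "subgroup ?C G" using cent_subgroup[OF xG] sub by (rule subgroups_Inter_pair)
    have g3C: "gamma 3 \<subseteq> ?C"
      using comm3[of _ x] x g3 MG xG by (auto simp: cent_eq)
    have xC: "x \<in> ?C" using centralizer_mod_self[OF one_is_normal xG] x by simp
    have g3sub: "gamma 3 \<subset> ?C" using g3C xC x by blast
    \<comment> \<open>Otherwise \<open>x\<close> is central in \<open>P1\<close>, so the center
      \<open>?Z\<close> strictly contains \<open>gamma 3\<close> and has index at most
      \<open>p\<close> in \<open>P1\<close>; this makes \<open>P1\<close> abelian.\<close>
    have "?C \<noteq> P1"
    proof
      assume "?C = P1"
      then have xcomm: "x \<otimes> y = y \<otimes> x" if "y \<in> P1" for y using that xG by (auto simp: cent_eq)
      let ?Z = "centralizer_mod G {\<one>} P1 \<inter> P1"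
      have Z: "subgroup ?Z G"
        using centralizer_mod_subgroup[OF one_is_normal MG] sub by (rule subgroups_Inter_pair)
      have "gamma 3 \<subseteq> ?Z"
        using comm3 g3 MG by (auto simp: centralizer_mod_def commutator_one_iff subset_iff)
      moreover have "x \<in> ?Z"
        using xcomm xG x MG by (auto simp: centralizer_mod_def commutator_one_iff subset_iff)
      ultimately have "gamma 3 \<subset> ?Z" using x by blast
      then have "p * card (gamma 3) \<le> card ?Z"
        using lower_central_subgroup Z by (intro subgroup_psubset_card)
      moreover have Z_eq: "?Z = P1"
      proof (rule ccontr)
        assume "?Z \<noteq> P1"
        then have "p * card ?Z \<le> card P1" using Z sub by (intro subgroup_psubset_card) auto
        moreover have "p * (p * card (gamma 3)) = card P1"
          using card_P1 card_3 k by (simp add: eval_nat_numeral)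
        ultimately have card_Z: "card P1 = p * card ?Z"
          using \<open>p * card (gamma 3) \<le> card ?Z\<close> by (metis le_antisym mult_le_mono2)
        have "h \<otimes> k = k \<otimes> h" if "h \<in> ?Z" "k \<in> P1" for h k
          using that MG by (auto simp: centralizer_mod_def commutator_one_iff subset_iff)
        then have "abelian_set G P1" using abelian_extend[OF Z sub _ card_Z] by blast
        then show False using nonab by simp
      qed
      have "x \<otimes> y = y \<otimes> x" if "x \<in> P1" "y \<in> P1" for x y
      proof -
        have "x \<in> ?Z" using that(1) Z_eq by blast
        then show ?thesis
          using that MG by (auto simp: centralizer_mod_def commutator_one_iff subset_iff)
      qed
      then show False using nonab by (simp add: abelian_set_def)
    qed
    then have "p * card ?C \<le> card P1" using C sub by (intro subgroup_psubset_card) auto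
    moreover have "p * card (gamma 3) \<le> card ?C"
      using g3sub C lower_central_subgroup by (intro subgroup_psubset_card)
    \<comment> \<open>\<open>?C\<close> lies strictly between groups of orders
      \<open>p ^ (m - 3)\<close> and \<open>p ^ (m - 1)\<close>.\<close>
    ultimately have card_C: "card ?C = p ^ (m - 2)"
      using p_gt_1 card_P1 card_3 k by (simp add: eval_nat_numeral)
    then have "card ?C = p * card (gamma 3)" using card_3 k by (simp add: eval_nat_numeral)
    then have "abelian_set G ?C"
      using comm3 by (intro abelian_extend[OF lower_central_subgroup C g3C]) auto
    with C g3C card_C show ?thesis by blast
  qed
  have abel3: "abelian_set G (gamma 3)" using comm3 g3 unfolding abelian_set_def by blast
  have count: "of_nat (card (commuting_in G P1 n)) =
      (?P + 1) * (?P ^ (m - 2)) ^ n - ?P * (?P ^ (m - 3)) ^ n" for n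
  proof -
    have "(of_nat (p ^ (m - 2)) - of_nat (p ^ (m - 3))) *
        (of_nat (card (commuting_in G P1 n)) - of_nat (card (commuting_in G (gamma 3) n)))
      = (of_nat (card P1) - of_nat (card (gamma 3))) * ((of_nat (p ^ (m - 2)) ^ n - of_nat (p ^ (m - 3)) ^ n) :: rat)"
    \<comment> \<open>As \<open>gamma 3\<close> is central in \<open>P1\<close>, it is contained in
      every centralizer and is itself the fixed intersection.\<close>
    proof (rule card_commuting_in_diff[where C = "\<lambda>x. cent x \<inter> P1" and Z = "gamma 3"])
      fix x assume x: "x \<in> P1 - gamma 3"
      then have "x \<in> carrier G" using MG by blast
      from cent_eq[OF this] show "cent x \<inter> P1 = {y \<in> P1. x \<otimes> y = y \<otimes> x}" using MG by blast
      show "cent x \<inter> P1 \<inter> gamma 3 = gamma 3" using C[OF x] by blast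
    qed (use finite_subgroup[OF sub] g3 card_3 C in auto)
    \<comment> \<open>The quotient of differences is
      \<open>(p ^ 2 - 1) / (p - 1) = p + 1\<close>.\<close>
    moreover have "of_nat (card P1) - of_nat (card (gamma 3)) =
        (of_nat (p ^ (m - 2)) - of_nat (p ^ (m - 3))) * (?P + 1)"
      using card_P1 card_3 k by (simp add: eval_nat_numeral algebra_simps)
    ultimately have "(of_nat (p ^ (m - 2)) - of_nat (p ^ (m - 3))) *
        (of_nat (card (commuting_in G P1 n)) - of_nat (card (commuting_in G (gamma 3) n)))
      = (of_nat (p ^ (m - 2)) - of_nat (p ^ (m - 3))) *
        ((?P + 1) * (of_nat (p ^ (m - 2)) ^ n - of_nat (p ^ (m - 3)) ^ n))"
      by (simp only: mult.assoc)
    moreover have "of_nat (p ^ (m - 2)) - of_nat (p ^ (m - 3)) \<noteq> (0 :: rat)"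
      using p_gt_1 k by (simp add: eval_nat_numeral)
    ultimately have "of_nat (card (commuting_in G P1 n)) - of_nat (card (commuting_in G (gamma 3) n)) =
      (?P + 1) * (of_nat (p ^ (m - 2)) ^ n - of_nat (p ^ (m - 3)) ^ n)"
      by (simp only: mult_cancel_left) simp
    moreover have "of_nat (card (commuting_in G (gamma 3) n)) = (?P ^ (m - 3)) ^ n"
      using card_commuting_in_abelian[OF finite_subgroup[OF lower_central_subgroup] abel3] card_3 by simp
    ultimately show ?thesis by (simp add: algebra_simps)
  qed
  \<comment> \<open>For \<open>i = 2\<close> this is the definition of \<open>P1\<close>; for larger
    \<open>i\<close> the group \<open>P1\<close> centralizes \<open>gamma i\<close> outright,
    because it centralizes \<open>gamma 3\<close>.\<close>
  have "P1 \<subseteq> centralizer_mod G (gamma (Suc (Suc i))) (gamma i)" if "2 \<le> i" for i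
  proof (cases "i = 2")
    case True
    then show ?thesis by (simp add: P1_def eval_nat_numeral)
  next
    case False
    then have "gamma i \<subseteq> gamma 3" using that by (intro lower_central_antimono) simp
    moreover have "{\<one>} \<subseteq> gamma (Suc (Suc i))"
      using subgroup.one_closed[OF lower_central_subgroup] by blast
    ultimately show ?thesis using comm centralizer_mod_mono by blast
  qed
  then have "of_nat (beta G n) * ?P ^ m = (?P + 1) * (?P ^ (m - 2)) ^ Suc n - ?P * (?P ^ (m - 3)) ^ Suc n
      + ?P ^ (m - 2) * ((?P ^ 2) ^ Suc n - ?P ^ Suc n)"
    using card_commuting_tuples[OF M, of "Suc n"] count[of "Suc n"]
    by (simp add: beta_times_p_power)
  moreover have "?P ^ m = ?P ^ (m - 2) * ?P ^ 2" "?P ^ (m - 2) = ?P * ?P ^ (m - 3)"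
    using k by (simp_all add: eval_nat_numeral)
  ultimately have "?P ^ (m - 2) * (?P ^ 2 * of_nat (beta G n)) = ?P ^ (m - 2) *
     ((?P + 1) * (?P ^ (m - 2)) ^ n - (?P ^ (m - 3)) ^ n + ?P ^ 2 * (?P ^ 2) ^ n - ?P * ?P ^ n)"
    by (simp add: algebra_simps)
  then show "?P ^ 2 * of_nat (beta G n) =
     (?P + 1) * (?P ^ (m - 2)) ^ n - (?P ^ (m - 3)) ^ n + ?P ^ 2 * (?P ^ 2) ^ n - ?P * ?P ^ n"
    using p_ne by (simp only: mult_cancel_left) simp
qed

end

section \<open>Geometric series\<close>

definition geom :: "'a :: field \<Rightarrow> 'a fps" where
  "geom a = inverse (1 - fps_const a * fps_X)"

lemma geom_mult: "(1 - fps_const a * fps_X) * geom a = 1"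
  unfolding geom_def by (rule inverse_mult_eq_1') simp

lemma geom_nth: "fps_nth (geom a) n = a ^ n"
proof -
  have "(1 - fps_const a * fps_X) * Abs_fps (\<lambda>n. a ^ n) = 1"
  proof (rule fps_ext)
    fix n
    show "fps_nth ((1 - fps_const a * fps_X) * Abs_fps (\<lambda>n. a ^ n)) n = fps_nth 1 n"
      by (cases n) (simp_all add: left_diff_distrib mult.assoc)
  qed
  then have "geom a = Abs_fps (\<lambda>n. a ^ n)"
    unfolding geom_def by (rule fps_inverse_unique)
  then show ?thesis by simp
qed

text \<open>The numerator is the difference of the two denominators. This turns a product of
  geometric series into a difference whose coefficients can be read off.\<close>

lemma geom_telescope:
  "geom u * (fps_const (v - u) * fps_X * geom v) = geom v - geom u"
proof -
  have "fps_const (v - u) * fps_X = (1 - fps_const u * fps_X) - (1 - fps_const v * fps_X)"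
    by (simp add: algebra_simps flip: fps_const_sub)
  then have "geom u * (fps_const (v - u) * fps_X * geom v) =
    ((1 - fps_const u * fps_X) * geom u) * geom v - ((1 - fps_const v * fps_X) * geom v) * geom u"
    by (simp only:) (simp only: algebra_simps)
  then show ?thesis by (simp add: geom_mult)
qed

text \<open>With \<open>P = p\<close> and \<open>Y = p ^ (m - 5)\<close>, the values
  \<open>W\<close>, \<open>V\<close>, \<open>U\<close> are \<open>p ^ (m - 4)\<close>,
  \<open>p ^ (m - 3)\<close>, \<open>p ^ (m - 2)\<close>; the left side holds the two middle
  summands of the nonabelian formula, times \<open>p ^ 2\<close>.\<close>

lemma geom_partial_fractions:
  fixes P Y :: "'a :: field"
  defines "W \<equiv> P * Y" and "V \<equiv> P ^ 2 * Y" and "U \<equiv> P ^ 3 * Y"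
  shows "fps_const (P ^ 2) * (geom P * (fps_const (W - 1) * fps_X * (1 - fps_const W * fps_X) * (geom U * geom V)
      + fps_const (V - Y) * fps_X * geom U))
    = fps_const (P + 1) * geom U - geom V - fps_const P * geom P"
proof -
  define p y x where "p = fps_const P" and "y = fps_const Y" and "x = (fps_X :: 'a fps)"
  \<comment> \<open>Writing every constant as a polynomial in \<open>p\<close> and \<open>y\<close>
    reduces the claim to a consequence of the three relations \<open>a\<close>, \<open>u\<close>,
    \<open>v\<close> in the ring of power series.\<close>
  have coeffs: "fps_const (P ^ 2) = p ^ 2" "fps_const (W - 1) = p * y - 1" "fps_const W = p * y"
    "fps_const (V - Y) = p ^ 2 * y - y" "fps_const (P + 1) = p + 1"
    by (simp_all add: p_def y_def W_def V_def fps_const_power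
        flip: fps_const_mult fps_const_sub fps_const_add)
  have a: "(1 - p * x) * geom P = 1"
    and u: "(1 - p ^ 3 * y * x) * geom U = 1"
    and v: "(1 - p ^ 2 * y * x) * geom V = 1"
    using geom_mult[of P] geom_mult[of U] geom_mult[of V]
    by (simp_all add: p_def y_def x_def U_def V_def fps_const_power)
  have "p ^ 2 * (geom P * ((p * y - 1) * x * (1 - p * y * x) * (geom U * geom V) + (p ^ 2 * y - y) * x * geom U))
    = (p + 1) * geom U - geom V - p * geom P"
    using a u v by algebra
  then show ?thesis unfolding coeffs p_def[symmetric] x_def[symmetric] .
qed

section \<open>The generating functions in the two cases\<close>

theorem theorem8p5:
  fixes G :: "('a, 'b) monoid_scheme" and p m :: nat
  assumes "maximal_class G p m"
    and "degree_of_commutativity G m > 0"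
  shows "((\<exists>H. maximal_subgroup H G \<and> abelian_set G H) \<longrightarrow>
           B_series G = inverse (1 - fps_const (of_nat p) * fps_X) *
             (1 + fps_const (of_nat p ^ (m - 2) - 1) * fps_X
                    * inverse (1 - fps_const (of_nat p ^ (m - 1)) * fps_X)
                + fps_const (of_nat p ^ 2 - of_nat p) * fps_X
                    * inverse (1 - fps_const (of_nat p ^ 2) * fps_X))) \<and>
         (comm_subgroup G (P_series G m 1) (P_series G m 3) = {\<one>\<^bsub>G\<^esub>} \<and>
         \<not> (\<exists>H. maximal_subgroup H G \<and> abelian_set G H) \<longrightarrow>
           B_series G = inverse (1 - fps_const (of_nat p) * fps_X) *
             (1 + fps_const (of_nat p ^ (m - 4) - 1) * fps_X
                    * (1 - fps_const (of_nat p ^ (m - 4)) * fps_X)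
                    * inverse ((1 - fps_const (of_nat p ^ (m - 2)) * fps_X)
                               * (1 - fps_const (of_nat p ^ (m - 3)) * fps_X))
                + fps_const (of_nat p ^ (m - 3) - of_nat p powi (int m - 5)) * fps_X
                    * inverse (1 - fps_const (of_nat p ^ (m - 2)) * fps_X)
                + fps_const (of_nat p ^ 2 - of_nat p) * fps_X
                    * inverse (1 - fps_const (of_nat p ^ 2) * fps_X)))"
proof -
  interpret maximal_class_group G p m
    using assms(1)
    by (simp add: maximal_class_def maximal_class_group_def maximal_class_group_axioms_def
        prime_power_group_def prime_power_group_axioms_def)
  let ?P = "of_nat p :: rat"
  have P: "?P \<noteq> 0" using p_ne by simp
  obtain k where k: "m = Suc (Suc k)" by (rule m_pred)
  have last: "geom ?P * (fps_const (?P ^ 2 - ?P) * fps_X * geom (?P ^ 2)) = geom (?P ^ 2) - geom ?P"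
    by (rule geom_telescope)
  have abelian_case: "B_series G = geom ?P *
             (1 + fps_const (?P ^ (m - 2) - 1) * fps_X * geom (?P ^ (m - 1))
                + fps_const (?P ^ 2 - ?P) * fps_X * geom (?P ^ 2))" (is "_ = ?R")
    if ex: "\<exists>H. maximal_subgroup H G \<and> abelian_set G H"
  proof -
    obtain H where H: "maximal_subgroup H G" "abelian_set G H" using ex by blast
    \<comment> \<open>Multiplication by \<open>p\<close> brings the coefficient into the form of a
      difference of ratios, so that the summand telescopes.\<close>
    have "fps_const (?P ^ (m - 1) - ?P) = fps_const ?P * fps_const (?P ^ (m - 2) - 1)"
      using k by (simp add: algebra_simps)
    then have "fps_const ?P * (geom ?P * (fps_const (?P ^ (m - 2) - 1) * fps_X * geom (?P ^ (m - 1))))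
      = geom ?P * (fps_const (?P ^ (m - 1) - ?P) * fps_X * geom (?P ^ (m - 1)))"
      by (simp only: ac_simps)
    also have "\<dots> = geom (?P ^ (m - 1)) - geom ?P" by (rule geom_telescope)
    finally have R: "fps_const ?P * ?R = fps_const ?P * geom ?P + (geom (?P ^ (m - 1)) - geom ?P)
        + fps_const ?P * (geom (?P ^ 2) - geom ?P)"
      by (simp only: distrib_left last mult_1_right)
    \<comment> \<open>Both sides are now combinations of geometric series, and their coefficients
      are compared with the formula for \<open>p * beta\<close>.\<close>
    have "fps_const ?P * B_series G = fps_const ?P * ?R"
      unfolding R using beta_abelian[OF H]
      by (simp add: fps_eq_iff B_series_def geom_nth algebra_simps)
    then show ?thesis using P by simp
  qed
  have nonabelian_case: "B_series G = geom ?P *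
             (1 + fps_const (?P ^ (m - 4) - 1) * fps_X
                    * (1 - fps_const (?P ^ (m - 4)) * fps_X)
                    * (geom (?P ^ (m - 2)) * geom (?P ^ (m - 3)))
                + fps_const (?P ^ (m - 3) - ?P powi (int m - 5)) * fps_X * geom (?P ^ (m - 2))
                + fps_const (?P ^ 2 - ?P) * fps_X * geom (?P ^ 2))"
      (is "_ = geom ?P * (1 + ?S + ?T + ?L)")
    if comm: "comm_subgroup G (P_series G m 1) (P_series G m 3) = {\<one>\<^bsub>G\<^esub>}"
      and none: "\<not> (\<exists>H. maximal_subgroup H G \<and> abelian_set G H)"
  proof -
    have "P_series G m 1 = P1" by (simp add: P_series_def P1_def centralizer_mod_def)
    moreover have "P_series G m 3 = gamma 3" using m_ge_4 by (simp add: P_series_def)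
    ultimately have "comm_subgroup G P1 (gamma 3) \<subseteq> {\<one>\<^bsub>G\<^esub>}" using comm by simp
    moreover have "P1 \<subseteq> carrier G" by (auto simp: P1_def centralizer_mod_def)
    ultimately have central: "P1 \<subseteq> centralizer_mod G {\<one>\<^bsub>G\<^esub>} (gamma 3)"
      using comm_subgroup_subset_iff[OF triv_subgroup _ lower_central_subset] by blast
    have nonab: "\<not> abelian_set G P1" using none P1_maximal by blast
    note beta = beta_nonabelian[OF nonab central]
    \<comment> \<open>Since \<open>5 \<le> m\<close>, the integer exponent in \<open>powi\<close> is
      the natural number \<open>j = m - 5\<close>.\<close>
    obtain j where j: "m = j + 5" using beta(1) by (metis le_add_diff_inverse2)
    have powi: "?P powi (int m - 5) = ?P ^ j" using j by simp
    have pow: "?P ^ (m - 2) = ?P ^ 3 * ?P ^ j" "?P ^ (m - 3) = ?P ^ 2 * ?P ^ j" "?P ^ (m - 4) = ?P * ?P ^ j"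
      using j by (simp_all add: eval_nat_numeral)
    have partial: "fps_const (?P ^ 2) * (geom ?P * (?S + ?T)) =
        fps_const (?P + 1) * geom (?P ^ (m - 2)) - geom (?P ^ (m - 3)) - fps_const ?P * geom ?P"
      unfolding pow powi by (rule geom_partial_fractions)
    have split: "geom ?P * (1 + ?S + ?T + ?L) = geom ?P + geom ?P * (?S + ?T) + (geom (?P ^ 2) - geom ?P)"
      by (simp only: distrib_left last mult_1_right add.assoc)
    have R: "fps_const (?P ^ 2) * (geom ?P * (1 + ?S + ?T + ?L)) =
        fps_const (?P ^ 2) * geom ?P +
        (fps_const (?P + 1) * geom (?P ^ (m - 2)) - geom (?P ^ (m - 3)) - fps_const ?P * geom ?P)
        + fps_const (?P ^ 2) * (geom (?P ^ 2) - geom ?P)"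
      unfolding split partial[symmetric] by (simp only: distrib_left)
    have "fps_const (?P ^ 2) * B_series G = fps_const (?P ^ 2) * (geom ?P * (1 + ?S + ?T + ?L))"
      unfolding R using beta(2) by (simp add: fps_eq_iff B_series_def geom_nth algebra_simps)
    then show ?thesis using P by simp
  qed
  show ?thesis
    \<comment> \<open>\<open>fps_inverse_mult\<close> splits the inverse of the product of two
      denominators, which the nonabelian case states as a product of two series.\<close>
    using abelian_case nonabelian_case unfolding geom_def fps_inverse_mult by blast
qed

end
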